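(* Let $m,n,r$ be positive integers with $r \le \min(m,n)$. Let $\mathbf{B} = \mathbf{A} + \mathbf{Z}$, where $\mathbf{A},\mathbf{Z} \in \mathbb{R}^{m\times n}$ and $\mathrm{rank}(\mathbf{A}) = r$. Let $\widehat{\mathbf{A}} = \widehat{\mathbf{U}}\widehat{\boldsymbol{\Sigma}}_1\widehat{\mathbf{V}}^\top$ be the best rank-$r$ approximation (rank-$r$ truncated singular value decomposition) of $\mathbf{B}$. Then $$\|\widehat{\mathbf{A}} - \mathbf{A}\|_q \le \begin{cases} (2^q+1)^{1/q}\,\|\mathbf{Z}_{\max(r)}\|_q, & 1\le q\le 2,\\ \sqrt{5}\,\|\mathbf{Z}_{\max(r)}\|_q, & 2\le q<\infty,\\ 2\,\|\mathbf{Z}_{\max(r)}\|, & q=\infty.\end{cases}$$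
   Context: For $\mathbf{M}\in\mathbb{R}^{m\times n}$ with singular values $\sigma_1(\mathbf{M})\ge \sigma_2(\mathbf{M})\ge\cdots\ge\sigma_{\min(m,n)}(\mathbf{M})\ge 0$, the Schatten-$q$ norm is $\|\mathbf{M}\|_q = \left(\sum_{i=1}^{\min(m,n)} \sigma_i(\mathbf{M})^q\right)^{1/q}$ for $1\le q<\infty$, and $\|\mathbf{M}\|_\infty = \|\mathbf{M}\| = \sigma_1(\mathbf{M})$ is the spectral norm. Given a singular value decomposition $\mathbf{M} = \sum_{i=1}^{\min(m,n)}\sigma_i(\mathbf{M})\mathbf{u}_i\mathbf{v}_i^\top$, $\mathbf{M}_{\max(r)} = \sum_{i=1}^r \sigma_i(\mathbf{M})\mathbf{u}_i\mathbf{v}_i^\top$ is the best rank-$r$ approximation of $\mathbf{M}$. The singular value decomposition of $\mathbf{B}$ (singular values in decreasing order) is written $$\mathbf{B} = [\widehat{\mathbf{U}}\ \ \widehat{\mathbf{U}}_\perp]\begin{bmatrix}\widehat{\boldsymbol{\Sigma}}_1 & 0\\ 0& \widehat{\boldsymbol{\Sigma}}_2\end{bmatrix}\begin{bmatrix}\widehat{\mathbf{V}}^\top\\ \widehat{\mathbf{V}}_\perp^\top\end{bmatrix},$$ with $\widehat{\mathbf{U}}\in\mathbb{R}^{m\times r}$, $\widehat{\mathbf{V}}\in\mathbb{R}^{n\times r}$, $[\widehat{\mathbf{U}}\ \widehat{\mathbf{U}}_\perp]$ and $[\widehat{\mathbf{V}}\ \widehat{\mathbf{V}}_\perp]$ orthogonal,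 and $\widehat{\boldsymbol{\Sigma}}_1$ the $r\times r$ diagonal matrix of the $r$ largest singular values of $\mathbf{B}$; thus $\widehat{\mathbf{A}} = \mathbf{B}_{\max(r)}$. *)

theory Defs
  imports "HOL-Analysis.Analysis"
begin

text \<open>An \<open>m \<times> n\<close> real matrix has type \<open>real ^ 'n ^ 'm\<close> with \<open>m = CARD('m)\<close>, \<open>n = CARD('n)\<close>.
  Singular values and singular vectors are indexed by natural numbers starting at 1.\<close>

definition eigenspace :: "real ^ 'n ^ 'n \<Rightarrow> real \<Rightarrow> (real ^ 'n) set"
  where "eigenspace S \<mu> = {x. S *v x = \<mu> *\<^sub>R x}"

text \<open>Square roots of the eigenvalues of \<open>M\<^sup>T M\<close>, counted with multiplicity. As \<open>M\<^sup>T M\<close> is symmetric,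
  the dimension of an eigenspace is also the algebraic multiplicity. The multiset has \<open>n\<close> elements;
  if \<open>n > m\<close>, the \<open>n - m\<close> smallest ones are 0 and are not singular values of \<open>M\<close>.\<close>

definition sqrt_gram_eigenvalues :: "real ^ 'n ^ 'm \<Rightarrow> real multiset"
  where "sqrt_gram_eigenvalues M =
    (\<Sum>\<mu> \<in> {\<mu>. eigenspace (transpose M ** M) \<mu> \<noteq> {0}}.
       replicate_mset (dim (eigenspace (transpose M ** M) \<mu>)) (sqrt \<mu>))"

text \<open>The \<open>i\<close>-th largest singular value, meaningful for \<open>1 \<le> i \<le> min m n\<close>.\<close>

definition singular_value :: "real ^ 'n ^ 'm \<Rightarrow> nat \<Rightarrow> real"
  where "singular_value M i = rev (sorted_list_of_multiset (sqrt_gram_eigenvalues M)) ! (i - 1)"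

definition schatten_norm :: "real \<Rightarrow> real ^ 'n ^ 'm \<Rightarrow> real"
  where "schatten_norm q M =
    (\<Sum>i = 1..min CARD('m) CARD('n). singular_value M i powr q) powr (1 / q)"

definition spectral_norm :: "real ^ 'n ^ 'm \<Rightarrow> real"
  where "spectral_norm M = singular_value M 1"

definition outer_prod :: "real ^ 'm \<Rightarrow> real ^ 'n \<Rightarrow> real ^ 'n ^ 'm"
  where "outer_prod u v = (\<chi> i j. u $ i * v $ j)"

definition orthonormal_basis :: "(nat \<Rightarrow> real ^ 'k) \<Rightarrow> bool"
  where "orthonormal_basis u \<longleftrightarrow>
    (\<forall>i \<in> {1..CARD('k)}. \<forall>j \<in> {1..CARD('k)}. u i \<bullet> u j = (if i = j then 1 else 0))"

text \<open>The vectors \<open>u\<close> and \<open>v\<close> are the columns of the two orthogonal factors of a full singular value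
  decomposition of \<open>M\<close>.\<close>

definition is_svd :: "real ^ 'n ^ 'm \<Rightarrow> (nat \<Rightarrow> real ^ 'm) \<Rightarrow> (nat \<Rightarrow> real ^ 'n) \<Rightarrow> bool"
  where "is_svd M u v \<longleftrightarrow> orthonormal_basis u \<and> orthonormal_basis v \<and>
    M = (\<Sum>i = 1..min CARD('m) CARD('n). singular_value M i *\<^sub>R outer_prod (u i) (v i))"

text \<open>A relation rather than a function: if \<open>\<sigma>\<^sub>r = \<sigma>\<^sub>r\<^sub>+\<^sub>1 > 0\<close>, the truncation depends on the chosen
  decomposition.\<close>

definition is_truncated_svd :: "nat \<Rightarrow> real ^ 'n ^ 'm \<Rightarrow> real ^ 'n ^ 'm \<Rightarrow> bool"
  where "is_truncated_svd r M X \<longleftrightarrow>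
    (\<exists>u v. is_svd M u v \<and> X = (\<Sum>i = 1..r. singular_value M i *\<^sub>R outer_prod (u i) (v i)))"

end

theory Submission
  imports Defs
begin

text \<open>
  Write \<open>\<sigma>\<^sub>i\<close> for \<open>singular_value _ i\<close> and let \<open>P\<close> be the orthogonal projection to the first \<open>r\<close> left singular
  vectors of \<open>B\<close>, so that \<open>A_hat = P B\<close>. Then \<open>A_hat - A = X + Y\<close> with \<open>X = P Z\<close> and \<open>Y = P A - A\<close>. Both
  summands have rank at most \<open>r\<close> and their ranges are orthogonal to each other.

  As \<open>P\<close> is a contraction, \<open>\<sigma>\<^sub>i(X) \<le> \<sigma>\<^sub>i(Z)\<close>, hence the Schatten norm of \<open>X\<close> is at most that of \<open>Z_max\<close>. For \<open>Y\<close>,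
  write \<open>Y = (P B - B) + (Z - P Z)\<close>. The \<open>i\<close>-th singular value of \<open>P B - B\<close> is \<open>\<sigma>\<^sub>r\<^sub>+\<^sub>i(B)\<close>,
  or 0 if that index is out of range (\<open>svd_with_remainder\<close>); it is at most \<open>\<sigma>\<^sub>i(Z)\<close> by Weyl's inequality, because \<open>A = B - Z\<close> has rank \<open>r\<close>
  (\<open>singular_value_add_le\<close>). As only the first \<open>r\<close> singular values of \<open>Y\<close> count, the triangle
  inequality for the \<open>q\<close>-norm of the \<open>r\<close> largest singular values (\<open>truncated_norm_triangle\<close>) bounds the norm
  of \<open>Y\<close> by twice that of \<open>Z_max\<close>.

  For orthogonal ranges, the \<open>q\<close>-th powers of the Schatten norms are subadditive when \<open>q \<le> 2\<close>
  (\<open>schatten_norm_add_le_2\<close>), and their squares are when \<open>q \<ge> 2\<close> (\<open>schatten_norm_add_ge_2\<close>). Inserting the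
  bounds 1 and 2 gives the constants \<open>(1 + 2 powr q) powr (1 / q)\<close> and \<open>sqrt (1 + 2\<^sup>2)\<close>. For the spectral
  norm, \<open>A_hat - A = (P B - B) + Z\<close> and both summands have norm at most \<open>\<sigma>\<^sub>1(Z)\<close>.

  The norm inequalities rest on Jensen's inequality for \<open>x powr p\<close>, with weights built from squared inner
  products of orthonormal vectors; Bessel's inequality says that these weights sum to at most 1. Singular
  value decompositions are constructed by maximising \<open>y \<bullet> M x\<close> greedily, and a computation of the
  eigenspaces of the Gram matrix identifies the coefficients found in this way with the singular values.
\<close>

section \<open>Orthonormal families\<close>

text \<open>Orthonormality of a family of vectors with index set \<open>I\<close>; values outside \<open>I\<close> are irrelevant.\<close>

definition orthonormal_on :: "nat set \<Rightarrow> (nat \<Rightarrow> 'a::euclidean_space) \<Rightarrow> bool"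
  where "orthonormal_on I u \<longleftrightarrow> (\<forall>i \<in> I. \<forall>j \<in> I. u i \<bullet> u j = (if i = j then 1 else 0))"

lemma orthonormal_basis_iff:
  "orthonormal_basis (u :: nat \<Rightarrow> real ^ 'k) \<longleftrightarrow> orthonormal_on {1..CARD('k)} u"
  by (simp add: orthonormal_basis_def orthonormal_on_def)

lemma orthonormal_on_subset: "orthonormal_on I u \<Longrightarrow> J \<subseteq> I \<Longrightarrow> orthonormal_on J u"
  unfolding orthonormal_on_def by blast

lemma orthonormal_on_inner:
  "orthonormal_on I u \<Longrightarrow> i \<in> I \<Longrightarrow> j \<in> I \<Longrightarrow> u i \<bullet> u j = (if i = j then 1 else 0)"
  by (auto simp: orthonormal_on_def)

lemma orthonormal_on_comp:
  assumes u: "orthonormal_on I u" and f: "inj_on f J" "f ` J \<subseteq> I"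
  shows "orthonormal_on J (u \<circ> f)"
  unfolding orthonormal_on_def
proof (intro ballI)
  fix i j assume ij: "i \<in> J" "j \<in> J"
  then have "f i \<in> I" "f j \<in> I" using f(2) by auto
  from orthonormal_on_inner[OF u this] show "(u \<circ> f) i \<bullet> (u \<circ> f) j = (if i = j then 1 else 0)"
    using inj_on_eq_iff[OF f(1) ij] by simp
qed

lemma orthonormal_on_norm: "orthonormal_on I u \<Longrightarrow> i \<in> I \<Longrightarrow> norm (u i) = 1"
  by (simp add: norm_eq_sqrt_inner orthonormal_on_inner)

lemma orthonormal_on_inj: "orthonormal_on I u \<Longrightarrow> inj_on u I"
  by (rule inj_onI) (metis orthonormal_on_inner zero_neq_one)

lemma orthonormal_on_independent: "orthonormal_on I u \<Longrightarrow> independent (u ` I)"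
proof (rule pairwise_orthogonal_independent)
  assume u: "orthonormal_on I u"
  show "pairwise orthogonal (u ` I)"
    using u by (auto simp: pairwise_def orthogonal_def orthonormal_on_def)
  show "0 \<notin> u ` I"
    using orthonormal_on_norm[OF u] by fastforce
qed

lemma orthonormal_on_dim_span:
  assumes "orthonormal_on I u"
  shows "dim (span (u ` I)) = card I"
  using dim_eq_card_independent[OF orthonormal_on_independent[OF assms]]
    card_image[OF orthonormal_on_inj[OF assms]] by (simp add: dim_span)

lemma orthonormal_on_inner_sum:
  assumes "orthonormal_on I u" "finite I" "i \<in> I"
  shows "u i \<bullet> (\<Sum>j\<in>I. c j *\<^sub>R u j) = c i"
proof -
  have "u i \<bullet> (\<Sum>j\<in>I. c j *\<^sub>R u j) = (\<Sum>j\<in>I. if i = j then c j else 0)"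
    unfolding inner_sum_right inner_scaleR_right
    by (rule sum.cong) (use assms in \<open>auto simp: orthonormal_on_inner\<close>)
  then show ?thesis using assms by simp
qed

lemma orthonormal_on_norm_sum:
  assumes "orthonormal_on I u" "finite I"
  shows "(norm (\<Sum>j\<in>I. c j *\<^sub>R u j))\<^sup>2 = (\<Sum>j\<in>I. (c j)\<^sup>2)"
proof -
  have "(norm (\<Sum>j\<in>I. c j *\<^sub>R u j))\<^sup>2 = (\<Sum>i\<in>I. c i * (u i \<bullet> (\<Sum>j\<in>I. c j *\<^sub>R u j)))"
    unfolding power2_norm_eq_inner by (subst (1) inner_sum_left) simp
  also have "\<dots> = (\<Sum>j\<in>I. (c j)\<^sup>2)"
    by (rule sum.cong) (use assms in \<open>auto simp: orthonormal_on_inner_sum power2_eq_square\<close>)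
  finally show ?thesis .
qed

text \<open>The expansion \<open>p\<close> is the orthogonal projection of \<open>x\<close> to the span of the family.\<close>

lemma orthonormal_on_pythagoras:
  assumes "orthonormal_on I u" "finite I"
  defines "p \<equiv> \<lambda>x. \<Sum>j\<in>I. (u j \<bullet> x) *\<^sub>R u j"
  shows "(norm x)\<^sup>2 = (\<Sum>j\<in>I. (u j \<bullet> x)\<^sup>2) + (norm (x - p x))\<^sup>2"
proof -
  have "p x \<bullet> x = (\<Sum>j\<in>I. (u j \<bullet> x)\<^sup>2)"
    by (simp add: p_def inner_sum_left power2_eq_square)
  moreover have "p x \<bullet> p x = (\<Sum>j\<in>I. (u j \<bullet> x)\<^sup>2)"
    using orthonormal_on_norm_sum[OF assms(1,2)] by (simp add: p_def power2_norm_eq_inner)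
  ultimately show ?thesis
    by (simp add: power2_norm_eq_inner inner_diff_left inner_diff_right inner_commute)
qed

lemma bessel_inequality:
  assumes "orthonormal_on I u" "finite I"
  shows "(\<Sum>j\<in>I. (u j \<bullet> x)\<^sup>2) \<le> (norm x)\<^sup>2"
  using orthonormal_on_pythagoras[OF assms, of x] by simp

lemma orthonormal_on_span_expansion:
  assumes "orthonormal_on I u" "finite I" "x \<in> span (u ` I)"
  shows "x = (\<Sum>j\<in>I. (u j \<bullet> x) *\<^sub>R u j)"
proof -
  define y where "y = x - (\<Sum>j\<in>I. (u j \<bullet> x) *\<^sub>R u j)"
  have "y \<bullet> z = 0" if "z \<in> u ` I" for z
  proof -
    obtain i where "i \<in> I" "z = u i" using \<open>z \<in> u ` I\<close> by blast
    then have "z \<bullet> y = 0"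
      unfolding y_def inner_diff_right by (simp add: orthonormal_on_inner_sum[OF assms(1,2)])
    then show ?thesis by (simp add: inner_commute)
  qed
  then have "orthogonal y z" if "z \<in> span (u ` I)" for z
    using orthogonal_to_span[OF that] by (auto simp: orthogonal_def)
  moreover have "y \<in> span (u ` I)"
    unfolding y_def using assms(3) by (intro span_diff span_sum span_mul) (auto intro: span_base)
  ultimately have "y = 0" by (meson orthogonal_self)
  then show ?thesis by (simp add: y_def)
qed

lemma orthonormal_on_span_parseval:
  assumes "orthonormal_on I u" "finite I" "x \<in> span (u ` I)"
  shows "(\<Sum>j\<in>I. (u j \<bullet> x)\<^sup>2) = (norm x)\<^sup>2"
  using orthonormal_on_pythagoras[OF assms(1,2), of x] orthonormal_on_span_expansion[OF assms] by simp

lemma orthonormal_basis_span: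
  fixes u :: "nat \<Rightarrow> real ^ 'k"
  assumes "orthonormal_basis u"
  shows "x \<in> span (u ` {1..CARD('k)})"
proof -
  have u: "orthonormal_on {1..CARD('k)} u" using assms by (simp add: orthonormal_basis_iff)
  have "dim (u ` {1..CARD('k)}) = DIM(real ^ 'k)"
    using orthonormal_on_dim_span[OF u] by (simp add: dim_span)
  then show ?thesis using dim_eq_full[of "u ` {1..CARD('k)}"] by simp
qed

lemma orthonormal_basis_expansion:
  fixes u :: "nat \<Rightarrow> real ^ 'k"
  assumes "orthonormal_basis u"
  shows "x = (\<Sum>j = 1..CARD('k). (u j \<bullet> x) *\<^sub>R u j)"
  using orthonormal_on_span_expansion[of "{1..CARD('k)}" u x] orthonormal_basis_span[OF assms] assms
  by (simp add: orthonormal_basis_iff)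

lemma exists_unit_orthogonal:
  fixes u :: "nat \<Rightarrow> 'a::euclidean_space"
  assumes "orthonormal_on I u" "card I < DIM('a)"
  shows "\<exists>x. norm x = 1 \<and> (\<forall>i\<in>I. u i \<bullet> x = 0)"
proof -
  have "dim (u ` I) < DIM('a)"
    using orthonormal_on_dim_span[OF assms(1)] assms(2) by (simp add: dim_span)
  then obtain x where x: "x \<noteq> 0" "\<And>y. y \<in> span (u ` I) \<Longrightarrow> orthogonal x y"
    using orthogonal_to_subspace_exists by metis
  have "u i \<bullet> x = 0" if "i \<in> I" for i
    using x(2)[of "u i"] that by (auto intro!: span_base simp: orthogonal_def inner_commute)
  then have "norm (x /\<^sub>R norm x) = 1 \<and> (\<forall>i\<in>I. u i \<bullet> (x /\<^sub>R norm x) = 0)"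
    using x(1) by auto
  then show ?thesis by blast
qed

lemma orthonormal_on_extend:
  assumes "orthonormal_on {1..k} u" "norm x = 1" "\<forall>i\<in>{1..k}. u i \<bullet> x = 0"
  shows "orthonormal_on {1..Suc k} (u(Suc k := x))"
proof -
  have "x \<bullet> x = 1" using assms(2) by (simp add: dot_square_norm)
  then show ?thesis using assms(1,3)
    by (auto simp: orthonormal_on_def inner_commute le_Suc_eq)
qed

lemma orthonormal_on_extend_to_basis:
  fixes u :: "nat \<Rightarrow> real ^ 'k"
  assumes "orthonormal_on {1..k} u" "k \<le> CARD('k)"
  shows "\<exists>u'. orthonormal_basis u' \<and> (\<forall>i\<in>{1..k}. u' i = u i)"
  using assms(2,1)
proof (induction k arbitrary: u rule: inc_induct)
  case base
  then show ?case by (auto simp: orthonormal_basis_iff)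
next
  case (step k)
  obtain x where x: "norm x = 1" "\<forall>i\<in>{1..k}. u i \<bullet> x = 0"
    using exists_unit_orthogonal[OF step.prems] step.hyps by auto
  obtain u' where "orthonormal_basis u'" "\<forall>i\<in>{1..Suc k}. u' i = (u(Suc k := x)) i"
    using step.IH[OF orthonormal_on_extend[OF step.prems x]] by blast
  then show ?case by (intro exI[of _ u']) auto
qed

text \<open>Fewer than \<open>k\<close> linear conditions have a nonzero common solution in a space of dimension \<open>k\<close>. The
  solution is a vector of that space orthogonal to the projections \<open>p w\<close> of the conditions to it.\<close>

lemma exists_span_orthogonal:
  fixes v :: "nat \<Rightarrow> 'a::euclidean_space"
  assumes "orthonormal_on {1..k} v" "finite W" "card W < k"
  shows "\<exists>x \<in> span (v ` {1..k}). x \<noteq> 0 \<and> (\<forall>w\<in>W. w \<bullet> x = 0)"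
proof -
  define p where "p w = (\<Sum>j\<in>{1..k}. (v j \<bullet> w) *\<^sub>R v j)" for w
  have p: "p w \<in> span (v ` {1..k})" for w
    unfolding p_def by (intro span_sum span_mul) (auto intro: span_base)
  have "dim (p ` W) < dim (v ` {1..k})"
  proof -
    have "dim (p ` W) \<le> card W"
      using dim_le_card'[of "p ` W"] card_image_le[OF assms(2), of p] assms(2) by simp
    also have "\<dots> < dim (v ` {1..k})"
      using orthonormal_on_dim_span[OF assms(1)] assms(3) by (simp add: dim_span)
    finally show ?thesis .
  qed
  moreover have "span (p ` W) \<subseteq> span (v ` {1..k})"
    using p by (intro span_minimal) auto
  ultimately have "span (p ` W) \<subset> span (v ` {1..k})"
    by (metis dim_span order_less_irrefl psubsetI)
  then obtain x where x: "x \<noteq> 0" "x \<in> span (v ` {1..k})" "\<And>y. y \<in> span (p ` W) \<Longrightarrow> orthogonal x y"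
    using orthogonal_to_subspace_exists_gen by metis
  have "w \<bullet> x = 0" if "w \<in> W" for w
  proof -
    have "w \<bullet> x = w \<bullet> (\<Sum>j\<in>{1..k}. (v j \<bullet> x) *\<^sub>R v j)"
      using orthonormal_on_span_expansion[OF assms(1) _ x(2)] by simp
    also have "\<dots> = x \<bullet> p w"
      by (simp add: p_def inner_sum_right inner_commute mult.commute)
    also have "\<dots> = 0"
      using x(3)[of "p w"] that by (auto intro: span_base simp: orthogonal_def)
    finally show ?thesis .
  qed
  then show ?thesis using x by blast
qed

section \<open>Existence of singular value decompositions\<close>

text \<open>Greedy construction: the next pair maximises \<open>y \<bullet> M x\<close> over unit vectors orthogonal to the pairs
  already chosen.\<close>

lemma exists_maximising_pair:
  fixes M :: "real ^ 'n ^ 'm"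
  assumes u: "orthonormal_on {1..k} u" and v: "orthonormal_on {1..k} v"
    and k: "k < min CARD('m) CARD('n)"
  obtains y x where "norm y = 1" "norm x = 1" "\<forall>j\<in>{1..k}. u j \<bullet> y = 0" "\<forall>j\<in>{1..k}. v j \<bullet> x = 0"
    "\<And>y' x'. \<forall>j\<in>{1..k}. u j \<bullet> y' = 0 \<Longrightarrow> \<forall>j\<in>{1..k}. v j \<bullet> x' = 0 \<Longrightarrow>
       y' \<bullet> (M *v x') \<le> (y \<bullet> (M *v x)) * norm y' * norm x'"
proof -
  define Y where "Y = sphere (0 :: real ^ 'm) 1 \<inter> (\<Inter>j\<in>{1..k}. {y. u j \<bullet> y = 0})"
  define X where "X = sphere (0 :: real ^ 'n) 1 \<inter> (\<Inter>j\<in>{1..k}. {x. v j \<bullet> x = 0})"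
  have Y_iff: "y \<in> Y \<longleftrightarrow> norm y = 1 \<and> (\<forall>j\<in>{1..k}. u j \<bullet> y = 0)" for y
    by (auto simp: Y_def)
  have X_iff: "x \<in> X \<longleftrightarrow> norm x = 1 \<and> (\<forall>j\<in>{1..k}. v j \<bullet> x = 0)" for x
    by (auto simp: X_def)
  have "compact Y" "compact X"
    unfolding Y_def X_def
    by (intro compact_Int_closed compact_sphere closed_INT ballI closed_hyperplane)+
  then have "compact (Y \<times> X)" by (rule compact_Times)
  moreover have "Y \<noteq> {}" "X \<noteq> {}"
    using exists_unit_orthogonal[OF u] exists_unit_orthogonal[OF v] k by (auto simp: ex_in_conv[symmetric] Y_iff X_iff)
  moreover have "continuous_on (Y \<times> X) (\<lambda>(y, x). y \<bullet> (M *v x))"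
    unfolding case_prod_unfold
    by (intro continuous_intros bounded_linear.continuous_on[OF matrix_vector_mul_bounded_linear])
  ultimately obtain p where p: "p \<in> Y \<times> X"
    "\<forall>p'\<in>Y \<times> X. (case p' of (y, x) \<Rightarrow> y \<bullet> (M *v x)) \<le> (case p of (y, x) \<Rightarrow> y \<bullet> (M *v x))"
    using continuous_attains_sup[of "Y \<times> X" "\<lambda>(y, x). y \<bullet> (M *v x)"] by auto
  obtain y x where yx: "p = (y, x)" by (cases p)
  have max: "y' \<bullet> (M *v x') \<le> (y \<bullet> (M *v x)) * norm y' * norm x'"
    if y': "\<forall>j\<in>{1..k}. u j \<bullet> y' = 0" and x': "\<forall>j\<in>{1..k}. v j \<bullet> x' = 0" for y' x'
  proof (cases "y' = 0 \<or> x' = 0")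
    case True
    then show ?thesis by auto
  next
    case False
    then have "y' /\<^sub>R norm y' \<in> Y" "x' /\<^sub>R norm x' \<in> X"
      using y' x' by (auto simp: Y_iff X_iff)
    then have "(y' /\<^sub>R norm y') \<bullet> (M *v (x' /\<^sub>R norm x')) \<le> y \<bullet> (M *v x)"
      using p(2) yx by auto
    then show ?thesis using False
      by (simp add: matrix_vector_mult_scaleR divide_simps mult.commute mult.left_commute split: if_splits)
  qed
  show thesis
    using that[of y x] p(1) max unfolding yx by (auto simp: Y_iff X_iff)
qed

text \<open>The first \<open>k\<close> steps of the greedy construction: \<open>k\<close> singular triples, such that the bilinear form
  \<open>y \<bullet> M x\<close> on the orthogonal complements of the chosen vectors is bounded by each of the \<open>s i\<close>. This
  bound keeps the sequence \<open>s\<close> decreasing in the next step.\<close>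

definition singular_system ::
  "real ^ 'n ^ 'm \<Rightarrow> nat \<Rightarrow> (nat \<Rightarrow> real) \<Rightarrow> (nat \<Rightarrow> real ^ 'm) \<Rightarrow> (nat \<Rightarrow> real ^ 'n) \<Rightarrow> bool"
  where "singular_system M k s u v \<longleftrightarrow> orthonormal_on {1..k} u \<and> orthonormal_on {1..k} v \<and>
    (\<forall>i\<in>{1..k}. 0 \<le> s i \<and> M *v v i = s i *\<^sub>R u i \<and> transpose M *v u i = s i *\<^sub>R v i) \<and>
    (\<forall>i\<in>{1..k}. \<forall>j\<in>{1..k}. i \<le> j \<longrightarrow> s j \<le> s i) \<and>
    (\<forall>i\<in>{1..k}. \<forall>y x. (\<forall>j\<in>{1..k}. u j \<bullet> y = 0) \<longrightarrow> (\<forall>j\<in>{1..k}. v j \<bullet> x = 0) \<longrightarrow>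
       y \<bullet> (M *v x) \<le> s i * norm y * norm x)"

text \<open>The equality case of Cauchy--Schwarz.\<close>

lemma eq_scaleR_if_norm_le_inner:
  fixes a y :: "'a::real_inner"
  assumes "norm y = 1" "a \<bullet> y = t" "norm a \<le> t"
  shows "a = t *\<^sub>R y"
proof -
  have "(norm (a - t *\<^sub>R y))\<^sup>2 = a \<bullet> a - 2 * t * (a \<bullet> y) + t\<^sup>2 * (y \<bullet> y)"
    unfolding power2_norm_eq_inner
    by (simp add: inner_diff_left inner_diff_right inner_commute algebra_simps power2_eq_square)
  also have "\<dots> = (norm a)\<^sup>2 - t\<^sup>2"
    using assms(1,2) by (simp add: dot_square_norm power2_eq_square)
  also have "\<dots> \<le> 0"
    using power_mono[OF assms(3) norm_ge_zero, of 2] by simp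
  finally show ?thesis by simp
qed

lemma exists_singular_system:
  fixes M :: "real ^ 'n ^ 'm"
  assumes "k \<le> min CARD('m) CARD('n)"
  shows "\<exists>s u v. singular_system M k s u v"
  using assms
proof (induction k)
  case 0
  then show ?case by (simp add: singular_system_def orthonormal_on_def)
next
  case (Suc k)
  obtain s u v where S: "singular_system M k s u v"
    using Suc.IH[OF Suc_leD[OF Suc.prems]] by blast
  have u: "orthonormal_on {1..k} u" and v: "orthonormal_on {1..k} v"
    and sys: "\<And>i. i \<in> {1..k} \<Longrightarrow> 0 \<le> s i" "\<And>i. i \<in> {1..k} \<Longrightarrow> M *v v i = s i *\<^sub>R u i"
      "\<And>i. i \<in> {1..k} \<Longrightarrow> transpose M *v u i = s i *\<^sub>R v i"
    and anti: "\<And>i j. i \<in> {1..k} \<Longrightarrow> j \<in> {1..k} \<Longrightarrow> i \<le> j \<Longrightarrow> s j \<le> s i"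
    and bound: "\<And>i y x. i \<in> {1..k} \<Longrightarrow> \<forall>j\<in>{1..k}. u j \<bullet> y = 0 \<Longrightarrow> \<forall>j\<in>{1..k}. v j \<bullet> x = 0 \<Longrightarrow>
       y \<bullet> (M *v x) \<le> s i * norm y * norm x"
    using S unfolding singular_system_def by blast+
  have "k < min CARD('m) CARD('n)" using Suc.prems by simp
  then obtain y x where y: "norm y = 1" "\<forall>j\<in>{1..k}. u j \<bullet> y = 0"
    and x: "norm x = 1" "\<forall>j\<in>{1..k}. v j \<bullet> x = 0"
    and max: "\<And>y' x'. \<forall>j\<in>{1..k}. u j \<bullet> y' = 0 \<Longrightarrow> \<forall>j\<in>{1..k}. v j \<bullet> x' = 0 \<Longrightarrow>
       y' \<bullet> (M *v x') \<le> (y \<bullet> (M *v x)) * norm y' * norm x'"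
    using exists_maximising_pair[OF u v] by metis
  define t where "t = y \<bullet> (M *v x)"
  have adj: "a \<bullet> (M *v b) = (transpose M *v a) \<bullet> b" for a b
    by (simp add: dot_lmul_matrix)
  \<comment> \<open>Replacing \<open>y\<close> by \<open>- y\<close> changes the sign of \<open>y \<bullet> M x\<close>.\<close>
  have "0 \<le> t"
    using max[of "- y" x] y x by (simp add: t_def)
  \<comment> \<open>Both \<open>M x\<close> and \<open>M\<^sup>T y\<close> are again orthogonal to the earlier pairs, so maximality bounds their norms
    by \<open>t\<close>; the equality case of Cauchy--Schwarz then forces \<open>M x = t y\<close> and \<open>M\<^sup>T y = t x\<close>.\<close>
  have "\<forall>j\<in>{1..k}. u j \<bullet> (M *v x) = 0"
    using sys(3) x(2) by (simp add: adj)
  then have "(M *v x) \<bullet> (M *v x) \<le> t * norm (M *v x)"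
    using max[of "M *v x" x] x by (simp add: t_def)
  then have "norm (M *v x) \<le> t"
    using \<open>0 \<le> t\<close> by (cases "M *v x = 0") (simp_all add: dot_square_norm power2_eq_square mult_le_cancel_right)
  then have Mx: "M *v x = t *\<^sub>R y"
    using eq_scaleR_if_norm_le_inner[OF y(1)] by (metis t_def inner_commute)
  have "\<forall>j\<in>{1..k}. v j \<bullet> (transpose M *v y) = 0"
  proof
    fix j assume j: "j \<in> {1..k}"
    have "v j \<bullet> (transpose M *v y) = y \<bullet> (M *v v j)" by (simp only: adj inner_commute)
    also have "\<dots> = s j * (u j \<bullet> y)" using sys(2)[OF j] by (simp add: inner_commute)
    finally show "v j \<bullet> (transpose M *v y) = 0" using y(2) j by simp
  qed
  then have "(transpose M *v y) \<bullet> (transpose M *v y) \<le> t * norm (transpose M *v y)"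
    using max[of y "transpose M *v y"] y by (simp add: t_def adj)
  then have "norm (transpose M *v y) \<le> t"
    using \<open>0 \<le> t\<close>
    by (cases "transpose M *v y = 0") (simp_all add: dot_square_norm power2_eq_square mult_le_cancel_right)
  moreover have "(transpose M *v y) \<bullet> x = t" by (simp add: t_def adj)
  ultimately have My: "transpose M *v y = t *\<^sub>R x"
    using eq_scaleR_if_norm_le_inner[OF x(1)] by blast
  have le: "t \<le> s i" if "i \<in> {1..k}" for i
    using bound[OF that y(2) x(2)] x y by (simp add: t_def)
  define s' u' v' where "s' = s(Suc k := t)" and "u' = u(Suc k := y)" and "v' = v(Suc k := x)"
  have "orthonormal_on {1..Suc k} u'" "orthonormal_on {1..Suc k} v'"
    unfolding u'_def v'_def using orthonormal_on_extend u v x y by blast+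
  moreover have "\<forall>i\<in>{1..Suc k}. 0 \<le> s' i \<and> M *v v' i = s' i *\<^sub>R u' i \<and> transpose M *v u' i = s' i *\<^sub>R v' i"
    using sys Mx My \<open>0 \<le> t\<close> by (auto simp: s'_def u'_def v'_def le_Suc_eq)
  moreover have "\<forall>i\<in>{1..Suc k}. \<forall>j\<in>{1..Suc k}. i \<le> j \<longrightarrow> s' j \<le> s' i"
    using anti le by (auto simp: s'_def le_Suc_eq)
  moreover have "b \<bullet> (M *v a) \<le> s' i * norm b * norm a"
    if i: "i \<in> {1..Suc k}" and b: "\<forall>j\<in>{1..Suc k}. u' j \<bullet> b = 0" and a: "\<forall>j\<in>{1..Suc k}. v' j \<bullet> a = 0" for i a b
  proof -
    have "u j \<bullet> b = 0" "v j \<bullet> a = 0" if "j \<in> {1..k}" for j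
      using bspec[OF b, of j] bspec[OF a, of j] that by (auto simp: u'_def v'_def)
    then have b': "\<forall>j\<in>{1..k}. u j \<bullet> b = 0" and a': "\<forall>j\<in>{1..k}. v j \<bullet> a = 0"
      by blast+
    show ?thesis
      using max[OF b' a'] bound[OF _ b' a'] i by (cases "i = Suc k") (auto simp: s'_def t_def)
  qed
  ultimately have "singular_system M (Suc k) s' u' v'"
    unfolding singular_system_def by blast
  then show ?case by blast
qed

text \<open>Products with a transposed matrix are kept in this form, because the lemmas on decompositions are
  applied to \<open>transpose M\<close> as well.\<close>

declare transpose_matrix_vector [simp del]

lemma outer_prod_mult_vec: "outer_prod u v *v x = (v \<bullet> x) *\<^sub>R u"
  by (simp add: outer_prod_def matrix_vector_mult_def inner_vec_def vec_eq_iff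
    sum_distrib_left mult_ac)

lemma transpose_outer_prod: "transpose (outer_prod u v) = outer_prod v u"
  by (simp add: outer_prod_def transpose_def vec_eq_iff mult.commute)

lemma sum_matrix_vec: "(\<Sum>i\<in>I. F i) *v x = (\<Sum>i\<in>I. F i *v x)"
  for F :: "'i \<Rightarrow> real ^ 'n ^ 'm"
  by (induction I rule: infinite_finite_induct) (auto simp: matrix_vector_mult_add_rdistrib)

lemma transpose_sum: "transpose (\<Sum>i\<in>I. F i) = (\<Sum>i\<in>I. transpose (F i))"
  for F :: "'i \<Rightarrow> real ^ 'n ^ 'm"
  by (simp add: transpose_def vec_eq_iff)

lemma matrix_vec_sum_scaled: "M *v (\<Sum>i\<in>I. c i *\<^sub>R x i) = (\<Sum>i\<in>I. c i *\<^sub>R (M *v x i))"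
  for M :: "real ^ 'n ^ 'm"
  by (simp add: linear_sum[OF matrix_vector_mul_linear] linear_scale[OF matrix_vector_mul_linear] o_def)

lemma matrix_eq_sum_outer_prod:
  fixes M :: "real ^ 'n ^ 'm"
  assumes "orthonormal_basis v"
  shows "M = (\<Sum>i = 1..CARD('n). outer_prod (M *v v i) (v i))"
proof -
  have "M *v x = (\<Sum>i = 1..CARD('n). outer_prod (M *v v i) (v i)) *v x" for x
  proof -
    have "M *v x = M *v (\<Sum>j = 1..CARD('n). (v j \<bullet> x) *\<^sub>R v j)"
      using orthonormal_basis_expansion[OF assms, of x] by simp
    then show ?thesis
      by (simp only: sum_matrix_vec outer_prod_mult_vec matrix_vec_sum_scaled)
  qed
  then show ?thesis unfolding matrix_eq by blast
qed

text \<open>A full singular value decomposition of \<open>M\<close> with coefficients \<open>s\<close>, which are required to be nonnegative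
  and decreasing. They are then the singular values, by \<open>svd_with_singular_value\<close>.\<close>

definition svd_with :: "(nat \<Rightarrow> real) \<Rightarrow> real ^ 'n ^ 'm \<Rightarrow> (nat \<Rightarrow> real ^ 'm) \<Rightarrow> (nat \<Rightarrow> real ^ 'n) \<Rightarrow> bool"
  where "svd_with s M u v \<longleftrightarrow> orthonormal_basis u \<and> orthonormal_basis v \<and>
    (\<forall>i\<in>{1..min CARD('m) CARD('n)}. 0 \<le> s i) \<and>
    (\<forall>i\<in>{1..min CARD('m) CARD('n)}. \<forall>j\<in>{1..min CARD('m) CARD('n)}. i \<le> j \<longrightarrow> s j \<le> s i) \<and>
    M = (\<Sum>i = 1..min CARD('m) CARD('n). s i *\<^sub>R outer_prod (u i) (v i))"

lemma svd_with_transpose: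
  fixes M :: "real ^ 'n ^ 'm"
  assumes "svd_with s M u v"
  shows "svd_with s (transpose M) v u"
proof -
  have "transpose M = transpose (\<Sum>i = 1..min CARD('m) CARD('n). s i *\<^sub>R outer_prod (u i) (v i))"
    by (rule arg_cong[of _ _ transpose]) (use assms in \<open>simp add: svd_with_def\<close>)
  also have "\<dots> = (\<Sum>i = 1..min CARD('n) CARD('m). s i *\<^sub>R outer_prod (v i) (u i))"
    by (simp add: transpose_sum transpose_scalar transpose_outer_prod min.commute)
  finally show ?thesis
    using assms unfolding svd_with_def min.commute[of "CARD('n)" "CARD('m)"] by blast
qed

lemma svd_with_mult:
  fixes M :: "real ^ 'n ^ 'm"
  assumes "svd_with s M u v"
  shows "M *v x = (\<Sum>i = 1..min CARD('m) CARD('n). (s i * (v i \<bullet> x)) *\<^sub>R u i)"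
proof -
  have "M *v x = (\<Sum>i = 1..min CARD('m) CARD('n). s i *\<^sub>R outer_prod (u i) (v i)) *v x"
    using assms by (simp add: svd_with_def)
  then show ?thesis
    by (simp add: sum_matrix_vec outer_prod_mult_vec scaleR_matrix_vector_assoc[symmetric])
qed

lemma svd_with_norm:
  fixes M :: "real ^ 'n ^ 'm"
  assumes "svd_with s M u v"
  shows "(norm (M *v x))\<^sup>2 = (\<Sum>i = 1..min CARD('m) CARD('n). (s i)\<^sup>2 * (v i \<bullet> x)\<^sup>2)"
proof -
  have "orthonormal_on {1..min CARD('m) CARD('n)} u"
    using assms orthonormal_on_subset[of "{1..CARD('m)}" u "{1..min CARD('m) CARD('n)}"]
    by (auto simp: svd_with_def orthonormal_basis_iff)
  from orthonormal_on_norm_sum[OF this] show ?thesis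
    by (simp add: svd_with_mult[OF assms] power_mult_distrib)
qed

text \<open>After \<open>min m n\<close> steps of the greedy construction one of the two families is a basis. The other one
  is extended to a basis, and \<open>M\<close> or its transpose is determined by the values on the full one.\<close>

lemma exists_svd_with:
  fixes M :: "real ^ 'n ^ 'm"
  shows "\<exists>s u v. svd_with s M u v"
proof -
  define N where "N = min CARD('m) CARD('n)"
  obtain s u v where S: "singular_system M N s u v"
    using exists_singular_system[of N M] by (auto simp: N_def)
  have u: "orthonormal_on {1..N} u" and v: "orthonormal_on {1..N} v"
    and sys: "\<And>i. i \<in> {1..N} \<Longrightarrow> 0 \<le> s i" "\<And>i. i \<in> {1..N} \<Longrightarrow> M *v v i = s i *\<^sub>R u i"
      "\<And>i. i \<in> {1..N} \<Longrightarrow> transpose M *v u i = s i *\<^sub>R v i"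
    and anti: "\<forall>i\<in>{1..N}. \<forall>j\<in>{1..N}. i \<le> j \<longrightarrow> s j \<le> s i"
    using S unfolding singular_system_def by blast+
  obtain u' where u': "orthonormal_basis u'" "\<forall>i\<in>{1..N}. u' i = u i"
    using orthonormal_on_extend_to_basis[OF u] by (auto simp: N_def)
  obtain v' where v': "orthonormal_basis v'" "\<forall>i\<in>{1..N}. v' i = v i"
    using orthonormal_on_extend_to_basis[OF v] by (auto simp: N_def)
  have scale: "outer_prod (c *\<^sub>R a) b = c *\<^sub>R outer_prod a b" for c and a :: "real ^ 'x" and b :: "real ^ 'y"
    by (simp add: outer_prod_def vec_eq_iff)
  have scale': "outer_prod a (c *\<^sub>R b) = c *\<^sub>R outer_prod a b" for c and a :: "real ^ 'x" and b :: "real ^ 'y"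
    by (simp add: outer_prod_def vec_eq_iff)
  have "M = (\<Sum>i = 1..N. s i *\<^sub>R outer_prod (u' i) (v' i))"
  proof (cases "CARD('n) \<le> CARD('m)")
    case True
    then have "M = (\<Sum>i = 1..N. outer_prod (M *v v' i) (v' i))"
      using matrix_eq_sum_outer_prod[OF v'(1), of M] by (simp add: N_def)
    also have "\<dots> = (\<Sum>i = 1..N. s i *\<^sub>R outer_prod (u' i) (v' i))"
    proof (rule sum.cong[OF refl])
      fix i assume i: "i \<in> {1..N}"
      then have "M *v v' i = s i *\<^sub>R u' i" using u'(2) v'(2) sys(2) by metis
      then show "outer_prod (M *v v' i) (v' i) = s i *\<^sub>R outer_prod (u' i) (v' i)" by (simp only: scale)
    qed
    finally show ?thesis .
  next
    case False
    then have "transpose M = (\<Sum>i = 1..N. outer_prod (transpose M *v u' i) (u' i))"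
      using matrix_eq_sum_outer_prod[OF u'(1), of "transpose M"] by (simp add: N_def)
    then have "M = transpose (\<Sum>i = 1..N. outer_prod (transpose M *v u' i) (u' i))"
      by (metis transpose_transpose)
    also have "\<dots> = (\<Sum>i = 1..N. outer_prod (u' i) (transpose M *v u' i))"
      by (simp only: transpose_sum transpose_outer_prod)
    also have "\<dots> = (\<Sum>i = 1..N. s i *\<^sub>R outer_prod (u' i) (v' i))"
    proof (rule sum.cong[OF refl])
      fix i assume i: "i \<in> {1..N}"
      then have "transpose M *v u' i = s i *\<^sub>R v' i" using u'(2) v'(2) sys(3) by metis
      then show "outer_prod (u' i) (transpose M *v u' i) = s i *\<^sub>R outer_prod (u' i) (v' i)"
        by (simp only: scale')
    qed
    finally show ?thesis .
  qed
  then have "svd_with s M u' v'"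
    using u' v' sys anti by (simp add: svd_with_def N_def)
  then show ?thesis by blast
qed

section \<open>Uniqueness of the singular values\<close>

lemma sum_singleton_mset: "finite S \<Longrightarrow> (\<Sum>i\<in>S. {#c#}) = replicate_mset (card S) c"
  by (induction S rule: finite_induct) auto

text \<open>If \<open>n > m\<close>, the vectors \<open>v i\<close> with \<open>i > m\<close> span the part of the kernel that no coefficient describes;
  the function \<open>t\<close> assigns them the coefficient 0.\<close>

lemma svd_with_eigenspace:
  fixes M :: "real ^ 'n ^ 'm"
  assumes "svd_with s M u v"
  defines "t \<equiv> \<lambda>i. if i \<le> min CARD('m) CARD('n) then s i else 0"
  shows "eigenspace (transpose M ** M) \<mu> = span (v ` {i \<in> {1..CARD('n)}. (t i)\<^sup>2 = \<mu>})"
proof -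
  define N where "N = min CARD('m) CARD('n)"
  have N: "{1..N} \<subseteq> {1..CARD('n)}" "{1..N} \<subseteq> {1..CARD('m)}" by (auto simp: N_def)
  have v: "orthonormal_on {1..CARD('n)} v" and v': "orthonormal_basis v"
    using assms(1) by (auto simp: svd_with_def orthonormal_basis_iff)
  have u: "orthonormal_on {1..N} u"
    using assms(1) orthonormal_on_subset[of "{1..CARD('m)}" u] N by (auto simp: svd_with_def orthonormal_basis_iff)
  have gram: "(transpose M ** M) *v x = (\<Sum>i = 1..CARD('n). ((t i)\<^sup>2 * (v i \<bullet> x)) *\<^sub>R v i)" for x
  proof -
    have Mx: "M *v x = (\<Sum>i = 1..N. (s i * (v i \<bullet> x)) *\<^sub>R u i)"
      using svd_with_mult[OF assms(1)] by (simp add: N_def)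
    have "(transpose M ** M) *v x = transpose M *v (M *v x)"
      by (simp only: matrix_vector_mul_assoc)
    also have "\<dots> = (\<Sum>i = 1..N. (s i * (u i \<bullet> (M *v x))) *\<^sub>R v i)"
      using svd_with_mult[OF svd_with_transpose[OF assms(1)], of "M *v x"]
      by (simp add: N_def min.commute)
    also have "\<dots> = (\<Sum>i = 1..N. ((t i)\<^sup>2 * (v i \<bullet> x)) *\<^sub>R v i)"
    proof (rule sum.cong[OF refl])
      fix i assume i: "i \<in> {1..N}"
      then have "u i \<bullet> (M *v x) = t i * (v i \<bullet> x)"
        unfolding Mx using orthonormal_on_inner_sum[OF u _ i] by (simp add: t_def N_def)
      then show "(s i * (u i \<bullet> (M *v x))) *\<^sub>R v i = ((t i)\<^sup>2 * (v i \<bullet> x)) *\<^sub>R v i"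
        using i by (simp add: t_def N_def power2_eq_square)
    qed
    also have "\<dots> = (\<Sum>i = 1..CARD('n). ((t i)\<^sup>2 * (v i \<bullet> x)) *\<^sub>R v i)"
      by (rule sum.mono_neutral_left) (use N in \<open>auto simp: t_def N_def\<close>)
    finally show ?thesis .
  qed
  have coeff: "v i \<bullet> ((transpose M ** M) *v x) = (t i)\<^sup>2 * (v i \<bullet> x)" if "i \<in> {1..CARD('n)}" for i x
    unfolding gram using orthonormal_on_inner_sum[OF v _ that] by simp
  show ?thesis
  proof (intro equalityI subsetI)
    fix x assume "x \<in> eigenspace (transpose M ** M) \<mu>"
    then have eig: "(transpose M ** M) *v x = \<mu> *\<^sub>R x" by (simp only: eigenspace_def mem_Collect_eq)
    have zero: "v i \<bullet> x = 0" if "i \<in> {1..CARD('n)}" "(t i)\<^sup>2 \<noteq> \<mu>" for i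
    proof -
      have "\<mu> * (v i \<bullet> x) = (t i)\<^sup>2 * (v i \<bullet> x)"
        using coeff[OF that(1), of x] unfolding eig by simp
      then show ?thesis using that(2) by auto
    qed
    have "x = (\<Sum>j = 1..CARD('n). (v j \<bullet> x) *\<^sub>R v j)"
      by (rule orthonormal_basis_expansion[OF v'])
    also have "\<dots> = (\<Sum>j \<in> {i \<in> {1..CARD('n)}. (t i)\<^sup>2 = \<mu>}. (v j \<bullet> x) *\<^sub>R v j)"
      by (rule sum.mono_neutral_right) (use zero in auto)
    also have "\<dots> \<in> span (v ` {i \<in> {1..CARD('n)}. (t i)\<^sup>2 = \<mu>})"
      by (intro span_sum span_mul) (auto intro: span_base)
    finally show "x \<in> span (v ` {i \<in> {1..CARD('n)}. (t i)\<^sup>2 = \<mu>})" .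
  next
    fix x assume x: "x \<in> span (v ` {i \<in> {1..CARD('n)}. (t i)\<^sup>2 = \<mu>})"
    have "(transpose M ** M) *v v i = \<mu> *\<^sub>R v i" if "i \<in> {1..CARD('n)}" "(t i)\<^sup>2 = \<mu>" for i
    proof -
      have "(transpose M ** M) *v v i = (\<Sum>j = 1..CARD('n). if j = i then \<mu> *\<^sub>R v i else 0)"
        unfolding gram by (rule sum.cong) (use that orthonormal_on_inner[OF v] in auto)
      then show ?thesis using that by simp
    qed
    then have "v ` {i \<in> {1..CARD('n)}. (t i)\<^sup>2 = \<mu>} \<subseteq> eigenspace (transpose M ** M) \<mu>"
      unfolding eigenspace_def by blast
    moreover have "subspace (eigenspace (transpose M ** M) \<mu>)"
      unfolding eigenspace_def subspace_def
      by (simp add: matrix_vector_right_distrib matrix_vector_mult_scaleR scaleR_add_right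
        del: matrix_vector_mul_assoc)
    ultimately show "x \<in> eigenspace (transpose M ** M) \<mu>"
      using x span_minimal by blast
  qed
qed

text \<open>The coefficients of a decomposition are determined by the matrix.\<close>

lemma svd_with_singular_value:
  fixes M :: "real ^ 'n ^ 'm"
  assumes "svd_with s M u v" and i: "i \<in> {1..min CARD('m) CARD('n)}"
  shows "singular_value M i = s i"
proof -
  define N where "N = min CARD('m) CARD('n)"
  define t where "t i = (if i \<le> N then s i else 0)" for i
  define S where "S \<mu> = {i \<in> {1..CARD('n)}. (t i)\<^sup>2 = \<mu>}" for \<mu>
  have s: "\<And>i. i \<in> {1..N} \<Longrightarrow> 0 \<le> s i" "\<And>i j. i \<in> {1..N} \<Longrightarrow> j \<in> {1..N} \<Longrightarrow> i \<le> j \<Longrightarrow> s j \<le> s i"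
    and v: "orthonormal_on {1..CARD('n)} v"
    using assms(1) by (auto simp: svd_with_def N_def orthonormal_basis_iff)
  have t: "0 \<le> t i" if "1 \<le> i" for i using s that by (auto simp: t_def)
  have t_anti: "t j \<le> t i" if "1 \<le> i" "i \<le> j" for i j using s that by (auto simp: t_def)
  have vS: "orthonormal_on (S \<mu>) v" for \<mu>
    by (rule orthonormal_on_subset[OF v]) (auto simp: S_def)
  have eig: "eigenspace (transpose M ** M) \<mu> = span (v ` S \<mu>)" for \<mu>
    using svd_with_eigenspace[OF assms(1), of \<mu>] by (simp add: S_def t_def[abs_def] N_def)
  have dim: "dim (eigenspace (transpose M ** M) \<mu>) = card (S \<mu>)" for \<mu>
    unfolding eig by (rule orthonormal_on_dim_span[OF vS])
  have ne: "{\<mu>. eigenspace (transpose M ** M) \<mu> \<noteq> {0}} = (\<lambda>i. (t i)\<^sup>2) ` {1..CARD('n)}"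
  proof -
    have "eigenspace (transpose M ** M) \<mu> = {0} \<longleftrightarrow> S \<mu> = {}" for \<mu>
    proof
      assume "eigenspace (transpose M ** M) \<mu> = {0}"
      then have "card (S \<mu>) = 0" using dim[of \<mu>] by simp
      then show "S \<mu> = {}" by (simp add: S_def)
    qed (simp add: eig)
    then show ?thesis by (auto simp: S_def)
  qed
  have "sqrt_gram_eigenvalues M = (\<Sum>\<mu> \<in> (\<lambda>i. (t i)\<^sup>2) ` {1..CARD('n)}. \<Sum>i\<in>S \<mu>. {#t i#})"
    unfolding sqrt_gram_eigenvalues_def ne
  proof (rule sum.cong[OF refl])
    fix \<mu> assume "\<mu> \<in> (\<lambda>i. (t i)\<^sup>2) ` {1..CARD('n)}"
    have "(\<Sum>i\<in>S \<mu>. {#t i#}) = (\<Sum>i\<in>S \<mu>. {#sqrt \<mu>#})"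
      by (rule sum.cong) (use t in \<open>auto simp: S_def\<close>)
    then show "replicate_mset (dim (eigenspace (transpose M ** M) \<mu>)) (sqrt \<mu>) = (\<Sum>i\<in>S \<mu>. {#t i#})"
      by (simp add: dim sum_singleton_mset S_def)
  qed
  also have "\<dots> = (\<Sum>i \<in> {1..CARD('n)}. {#t i#})"
    unfolding S_def by (rule sum.image_gen[symmetric]) simp
  also have "\<dots> = mset (rev (map t [1..<Suc CARD('n)]))"
  proof -
    have "(\<Sum>i \<in> {1..k}. {#t i#}) = mset (rev (map t [1..<Suc k]))" for k
      by (induction k) auto
    then show ?thesis .
  qed
  finally have "sorted_list_of_multiset (sqrt_gram_eigenvalues M) = sort (rev (map t [1..<Suc CARD('n)]))"
    by (simp only: sorted_list_of_multiset_mset)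
  also have "\<dots> = rev (map t [1..<Suc CARD('n)])"
    by (rule sorted_sort_id)
      (auto simp: sorted_rev_iff_nth_mono intro!: t_anti simp del: upt_Suc)
  finally show ?thesis
    using i by (auto simp: singular_value_def t_def N_def simp del: upt_Suc)
qed

lemma is_svd_iff_svd_with:
  "is_svd M u v \<longleftrightarrow> svd_with (singular_value M) M u v"
  for M :: "real ^ 'n ^ 'm"
proof -
  obtain s u' v' where s: "svd_with s M u' v'" using exists_svd_with by blast
  have "s i = singular_value M i" if "i \<in> {1..min CARD('m) CARD('n)}" for i
    using svd_with_singular_value[OF s that] by simp
  moreover have "\<forall>i\<in>{1..min CARD('m) CARD('n)}. 0 \<le> s i"
    "\<forall>i\<in>{1..min CARD('m) CARD('n)}. \<forall>j\<in>{1..min CARD('m) CARD('n)}. i \<le> j \<longrightarrow> s j \<le> s i"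
    using s unfolding svd_with_def by blast+
  ultimately show ?thesis
    by (simp add: is_svd_def svd_with_def)
qed

lemma exists_svd:
  fixes M :: "real ^ 'n ^ 'm"
  obtains u v where "svd_with (singular_value M) M u v"
proof -
  obtain s u v where s: "svd_with s M u v" using exists_svd_with by blast
  have *: "s i = singular_value M i" if "i \<in> {1..min CARD('m) CARD('n)}" for i
    using svd_with_singular_value[OF s that] by simp
  have "svd_with (singular_value M) M u v"
    using s * by (simp add: svd_with_def)
  then show thesis by (rule that)
qed

lemma singular_value_nonneg:
  fixes M :: "real ^ 'n ^ 'm"
  assumes "i \<in> {1..min CARD('m) CARD('n)}"
  shows "0 \<le> singular_value M i"
proof -
  obtain u v where "svd_with (singular_value M) M u v" by (rule exists_svd)
  then show ?thesis using assms unfolding svd_with_def by blast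
qed

lemma singular_value_antimono:
  fixes M :: "real ^ 'n ^ 'm"
  assumes "1 \<le> i" "i \<le> j" "j \<le> min CARD('m) CARD('n)"
  shows "singular_value M j \<le> singular_value M i"
proof -
  have "i \<in> {1..min CARD('m) CARD('n)}" "j \<in> {1..min CARD('m) CARD('n)}" using assms by auto
  moreover obtain u v where "svd_with (singular_value M) M u v" by (rule exists_svd)
  ultimately show ?thesis using assms(2) unfolding svd_with_def by blast
qed

section \<open>Comparison of singular values\<close>

text \<open>A min-max comparison in the manner of Courant, Fischer and Weyl: if \<open>X\<close> is dominated by \<open>Y\<close> on a
  subspace of codimension at most \<open>card W\<close>, the singular values of \<open>X\<close>, shifted by \<open>card W\<close>, are
  dominated by those of \<open>Y\<close>.\<close>

lemma singular_value_le_if_norm_le: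
  fixes X Y :: "real ^ 'n ^ 'm"
  assumes W: "finite W" and i: "1 \<le> i" "card W + i \<le> min CARD('m) CARD('n)"
    and le: "\<And>x. (\<And>w. w \<in> W \<Longrightarrow> w \<bullet> x = 0) \<Longrightarrow> norm (X *v x) \<le> norm (Y *v x)"
  shows "singular_value X (card W + i) \<le> singular_value Y i"
proof -
  define N where "N = min CARD('m) CARD('n)"
  define k where "k = card W + i"
  have N: "{1..N} \<subseteq> {1..CARD('n)}" and k: "k \<in> {1..N}" and iN: "i \<in> {1..N}"
    using i by (auto simp: N_def k_def)
  obtain u v where X: "svd_with (singular_value X) X u v" by (rule exists_svd)
  obtain a b where Y: "svd_with (singular_value Y) Y a b" by (rule exists_svd)
  have v: "orthonormal_on {1..N} v" and b: "orthonormal_on {1..N} b"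
    using X Y orthonormal_on_subset[OF _ N] by (auto simp: svd_with_def orthonormal_basis_iff)
  have vk: "orthonormal_on {1..k} v"
    using orthonormal_on_subset[OF v] k by auto
  have "card (W \<union> b ` {1..<i}) \<le> card W + card (b ` {1..<i})" by (rule card_Un_le)
  also have "\<dots> \<le> card W + (i - 1)" using card_image_le[of "{1..<i}" b] by simp
  also have "\<dots> < k" using i by (simp add: k_def)
  \<comment> \<open>A test vector in the span of the top \<open>k\<close> right singular vectors of \<open>X\<close> that is orthogonal to \<open>W\<close> and
    to the top \<open>i - 1\<close> right singular vectors of \<open>Y\<close>.\<close>
  finally obtain x where x: "x \<in> span (v ` {1..k})" "x \<noteq> 0"
    and orth: "\<And>w. w \<in> W \<union> b ` {1..<i} \<Longrightarrow> w \<bullet> x = 0"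
    using exists_span_orthogonal[OF vk, of "W \<union> b ` {1..<i}"] W by blast
  have "(singular_value X k)\<^sup>2 * (norm x)\<^sup>2 = (\<Sum>j = 1..k. (singular_value X k)\<^sup>2 * (v j \<bullet> x)\<^sup>2)"
    using orthonormal_on_span_parseval[OF vk _ x(1)] by (simp add: sum_distrib_left[symmetric])
  also have "\<dots> \<le> (\<Sum>j = 1..k. (singular_value X j)\<^sup>2 * (v j \<bullet> x)\<^sup>2)"
    using singular_value_antimono[of _ k X] singular_value_nonneg[of k X] k
    by (intro sum_mono mult_right_mono power_mono) (auto simp: N_def)
  also have "\<dots> \<le> (\<Sum>j = 1..N. (singular_value X j)\<^sup>2 * (v j \<bullet> x)\<^sup>2)"
    using k by (intro sum_mono2) auto
  also have "\<dots> = (norm (X *v x))\<^sup>2"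
    using svd_with_norm[OF X] by (simp add: N_def)
  also have "\<dots> \<le> (norm (Y *v x))\<^sup>2"
    using le orth by (intro power_mono) auto
  also have "\<dots> = (\<Sum>j = 1..N. (singular_value Y j)\<^sup>2 * (b j \<bullet> x)\<^sup>2)"
    using svd_with_norm[OF Y] by (simp add: N_def)
  also have "\<dots> \<le> (\<Sum>j = 1..N. (singular_value Y i)\<^sup>2 * (b j \<bullet> x)\<^sup>2)"
  proof (rule sum_mono)
    fix j assume j: "j \<in> {1..N}"
    show "(singular_value Y j)\<^sup>2 * (b j \<bullet> x)\<^sup>2 \<le> (singular_value Y i)\<^sup>2 * (b j \<bullet> x)\<^sup>2"
    proof (cases "j < i")
      case True
      then show ?thesis using orth[of "b j"] j by simp
    next
      case False
      then show ?thesis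
        using singular_value_antimono[of i j Y] singular_value_nonneg[of j Y] iN j
        by (intro mult_right_mono power_mono) (auto simp: N_def)
    qed
  qed
  also have "\<dots> \<le> (singular_value Y i)\<^sup>2 * (norm x)\<^sup>2"
    using bessel_inequality[OF b, of x] by (simp add: sum_distrib_left[symmetric] mult_left_mono)
  finally have "(singular_value X k)\<^sup>2 \<le> (singular_value Y i)\<^sup>2"
    using x(2) by (simp add: mult_le_cancel_right)
  then show ?thesis
    using singular_value_nonneg[of i Y] iN power2_le_imp_le by (auto simp: N_def k_def)
qed

lemma singular_value_mono:
  fixes X Y :: "real ^ 'n ^ 'm"
  assumes "i \<in> {1..min CARD('m) CARD('n)}" "\<And>x. norm (X *v x) \<le> norm (Y *v x)"
  shows "singular_value X i \<le> singular_value Y i"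
proof -
  have "singular_value X (card ({} :: (real ^ 'n) set) + i) \<le> singular_value Y i"
    by (rule singular_value_le_if_norm_le) (use assms(1) in \<open>auto intro: assms(2)\<close>)
  then show ?thesis by simp
qed

lemma singular_value_uminus:
  fixes X :: "real ^ 'n ^ 'm"
  assumes "i \<in> {1..min CARD('m) CARD('n)}"
  shows "singular_value (- X) i = singular_value X i"
proof -
  have "(- X) *v x = - (X *v x)" for x
    by (simp add: matrix_vector_mult_def vec_eq_iff sum_negf)
  then show ?thesis
    using assms by (intro antisym singular_value_mono) simp_all
qed

lemma singular_value_zero:
  assumes "i \<in> {1..min CARD('m) CARD('n)}"
  shows "singular_value (0 :: real ^ 'n ^ 'm) i = 0"
proof -
  obtain u v where "svd_with (singular_value (0 :: real ^ 'n ^ 'm)) (0 :: real ^ 'n ^ 'm) u v"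
    by (rule exists_svd)
  then have uv: "orthonormal_basis u" "orthonormal_basis v" by (auto simp: svd_with_def)
  then have "svd_with (\<lambda>_. 0) (0 :: real ^ 'n ^ 'm) u v"
    by (simp add: svd_with_def)
  from svd_with_singular_value[OF this assms] show ?thesis .
qed

text \<open>The vectors \<open>W\<close> form a basis of the row space.\<close>

lemma rank_kernel_vectors:
  fixes A :: "real ^ 'n ^ 'm"
  obtains W where "finite W" "card W = rank A" "\<And>x. (\<And>w. w \<in> W \<Longrightarrow> w \<bullet> x = 0) \<Longrightarrow> A *v x = 0"
proof -
  obtain W where W: "W \<subseteq> rows A" "independent W" "rows A \<subseteq> span W" "card W = dim (rows A)"
    using basis_exists by blast
  have zero: "A *v x = 0" if x: "\<And>w. w \<in> W \<Longrightarrow> w \<bullet> x = 0" for x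
  proof -
    have "orthogonal x w" if "w \<in> span W" for w
    proof (rule orthogonal_to_span[OF that])
      show "orthogonal x y" if "y \<in> W" for y
        using x[OF that] by (simp add: orthogonal_def inner_commute)
    qed
    then have "row i A \<bullet> x = 0" for i
    proof -
      have "row i A \<in> span W" using W(3) by (auto simp: rows_def)
      from \<open>\<And>w. w \<in> span W \<Longrightarrow> orthogonal x w\<close>[OF this] show ?thesis
        by (simp add: orthogonal_def inner_commute)
    qed
    then show ?thesis
      by (simp add: matrix_mult_dot row_def vec_eq_iff)
  qed
  show thesis
    by (rule that[of W]) (use W zero in \<open>auto simp: row_rank_def independent_imp_finite\<close>)
qed

text \<open>Weyl's inequality, with the first summand measured by its rank only.\<close>

lemma singular_value_add_le:
  fixes A Z :: "real ^ 'n ^ 'm"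
  assumes "1 \<le> i" "rank A + i \<le> min CARD('m) CARD('n)"
  shows "singular_value (A + Z) (rank A + i) \<le> singular_value Z i"
proof -
  obtain W where W: "finite W" "card W = rank A" "\<And>x. (\<And>w. w \<in> W \<Longrightarrow> w \<bullet> x = 0) \<Longrightarrow> A *v x = 0"
    using rank_kernel_vectors[of A] by blast
  show ?thesis
    unfolding W(2)[symmetric]
    by (rule singular_value_le_if_norm_le) (use W assms in \<open>simp_all add: matrix_vector_mult_add_rdistrib\<close>)
qed

text \<open>This is the special case \<open>Z = 0\<close> of Weyl's inequality.\<close>

lemma singular_value_eq_0_if_rank_less:
  fixes A :: "real ^ 'n ^ 'm"
  assumes "rank A < i" "i \<le> min CARD('m) CARD('n)"
  shows "singular_value A i = 0"
proof (rule antisym)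
  have "singular_value (A + 0) (rank A + (i - rank A)) \<le> singular_value (0 :: real ^ 'n ^ 'm) (i - rank A)"
    using assms by (intro singular_value_add_le) auto
  also have "\<dots> = 0" using assms by (intro singular_value_zero) auto
  finally show "singular_value A i \<le> 0" using assms(1) by simp
  show "0 \<le> singular_value A i" using assms by (intro singular_value_nonneg) auto
qed

section \<open>Jensen and Minkowski inequalities for powers\<close>

lemma powr_above_tangent:
  fixes x m p :: real
  assumes "1 \<le> p" "0 < m" "0 \<le> x"
  shows "m powr p + p * m powr (p - 1) * (x - m) \<le> x powr p"
proof (cases "x = 0")
  case True
  have "m powr (p - 1) * m = m powr p"
    using assms(2) by (simp add: powr_diff)
  then have "m powr p + p * m powr (p - 1) * (x - m) = (1 - p) * m powr p"
    using True by (simp add: algebra_simps)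
  then show ?thesis using True assms(1) by (simp add: mult_nonpos_nonneg)
next
  case False
  have "(p * m powr (p - 1)) * (x - m) \<le> x powr p - m powr p"
  proof (rule convex_on_imp_above_tangent)
    show "convex_on {0<..} (\<lambda>x. x powr p)" by (rule powr_convex[OF assms(1)])
    show "((\<lambda>x. x powr p) has_real_derivative p * m powr (p - 1)) (at m within {0<..})"
      by (rule has_field_derivative_at_within[OF has_real_derivative_powr[OF assms(2)]])
  qed (use assms False in \<open>auto simp: interior_open\<close>)
  then show ?thesis by simp
qed

text \<open>Jensen's inequality with weights of total mass at most 1; the missing mass may be placed at 0,
  where the power vanishes. The proof sums the tangent inequality at the mean \<open>m\<close>.\<close>

lemma sum_mult_powr_le:
  fixes d x :: "'i \<Rightarrow> real"
  assumes p: "1 \<le> p" and d: "\<And>i. i \<in> I \<Longrightarrow> 0 \<le> d i" "sum d I \<le> 1" and x: "\<And>i. i \<in> I \<Longrightarrow> 0 \<le> x i"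
  shows "(\<Sum>i\<in>I. d i * x i) powr p \<le> (\<Sum>i\<in>I. d i * x i powr p)"
proof (cases "(\<Sum>i\<in>I. d i * x i) = 0")
  case True
  then show ?thesis using d x by (simp add: sum_nonneg)
next
  case False
  define m where "m = (\<Sum>i\<in>I. d i * x i)"
  have m: "0 < m" using False d x by (simp add: m_def order_less_le sum_nonneg)
  have mp: "m powr (p - 1) * m = m powr p" using m by (simp add: powr_diff)
  have "m powr p \<le> m powr p * (1 + (p - 1) * (1 - sum d I))"
    using p d(2) by (intro mult_left_le[of _ "- (m powr p)", simplified] | simp add: mult_le_cancel_left1)+
  also have "\<dots> = m powr p * sum d I + p * (m powr (p - 1)) * (m - m * sum d I)"
    by (simp add: mp[symmetric] algebra_simps)
  also have "\<dots> = (\<Sum>i\<in>I. d i * (m powr p + p * m powr (p - 1) * (x i - m)))"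
  proof -
    have "(\<Sum>i\<in>I. d i * (x i - m)) = m - m * sum d I"
      by (simp add: m_def[symmetric] right_diff_distrib sum_subtractf sum_distrib_left mult.commute)
    then have "p * m powr (p - 1) * (m - m * sum d I) = (\<Sum>i\<in>I. p * m powr (p - 1) * (d i * (x i - m)))"
      by (metis sum_distrib_left)
    moreover have "m powr p * sum d I = (\<Sum>i\<in>I. d i * m powr p)"
      by (simp add: sum_distrib_right mult.commute[of "m powr p"])
    ultimately show ?thesis by (simp add: distrib_left sum.distrib mult_ac)
  qed
  also have "\<dots> \<le> (\<Sum>i\<in>I. d i * x i powr p)"
    using powr_above_tangent[OF p m] d(1) x by (intro sum_mono mult_left_mono) simp_all
  finally show ?thesis by (simp add: m_def)
qed

text \<open>The concave case follows from the convex one with exponent \<open>1 / p\<close>.\<close>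

lemma sum_mult_powr_ge:
  fixes d x :: "'i \<Rightarrow> real"
  assumes p: "0 < p" "p \<le> 1" and d: "\<And>i. i \<in> I \<Longrightarrow> 0 \<le> d i" "sum d I \<le> 1" and x: "\<And>i. i \<in> I \<Longrightarrow> 0 \<le> x i"
  shows "(\<Sum>i\<in>I. d i * x i powr p) \<le> (\<Sum>i\<in>I. d i * x i) powr p"
proof -
  have "(\<Sum>i\<in>I. d i * x i powr p) powr (1 / p) \<le> (\<Sum>i\<in>I. d i * (x i powr p) powr (1 / p))"
    using p d by (intro sum_mult_powr_le) auto
  also have "\<dots> = (\<Sum>i\<in>I. d i * x i)"
    using p(1) x by (intro sum.cong) (auto simp: powr_powr)
  finally have "((\<Sum>i\<in>I. d i * x i powr p) powr (1 / p)) powr p \<le> (\<Sum>i\<in>I. d i * x i) powr p"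
    using p(1) by (intro powr_mono2) auto
  then show ?thesis using p(1) d by (simp add: powr_powr sum_nonneg)
qed

text \<open>Let \<open>a\<close> and \<open>b\<close> be the two norms on the right. If one is 0, that family vanishes; otherwise
  \<open>x i + y i\<close> is \<open>a + b\<close> times a convex combination of the normalised entries \<open>x i / a\<close> and \<open>y i / b\<close>.\<close>

lemma minkowski_inequality_sum:
  fixes x y :: "'i \<Rightarrow> real"
  assumes p: "1 \<le> p" and x: "\<And>i. i \<in> I \<Longrightarrow> 0 \<le> x i" and y: "\<And>i. i \<in> I \<Longrightarrow> 0 \<le> y i"
  shows "(\<Sum>i\<in>I. (x i + y i) powr p) powr (1 / p)
    \<le> (\<Sum>i\<in>I. x i powr p) powr (1 / p) + (\<Sum>i\<in>I. y i powr p) powr (1 / p)"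
proof -
  have [simp]: "p \<noteq> 0" using p by simp
  define a b where "a = (\<Sum>i\<in>I. x i powr p) powr (1 / p)" and "b = (\<Sum>i\<in>I. y i powr p) powr (1 / p)"
  have ap: "a powr p = (\<Sum>i\<in>I. x i powr p)" and bp: "b powr p = (\<Sum>i\<in>I. y i powr p)"
    by (simp_all add: a_def b_def powr_powr sum_nonneg)
  have ab: "0 \<le> a" "0 \<le> b" by (simp_all add: a_def b_def)
  show ?thesis
  proof (cases "finite I")
    case False
    then show ?thesis by simp
  next
    case fin: True
    consider "a = 0" | "b = 0" | "0 < a" "0 < b" using ab by linarith
    then show ?thesis
    proof cases
      case 1
      then have "x i = 0" if "i \<in> I" for i
        using ap that fin by (auto simp: sum_nonneg_eq_0_iff)
      then show ?thesis by simp
    next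
      case 2
      then have "y i = 0" if "i \<in> I" for i
        using bp that fin by (auto simp: sum_nonneg_eq_0_iff)
      then show ?thesis by simp
    next
      case 3
      define l where "l = a / (a + b)"
      have l: "0 \<le> l" "l \<le> 1" and l': "1 - l = b / (a + b)" using 3 by (auto simp: l_def field_simps)
      have "(x i + y i) powr p \<le> (a + b) powr p * (l * (x i / a) powr p + (1 - l) * (y i / b) powr p)"
        if i: "i \<in> I" for i
      proof -
        have "x i + y i = (a + b) * (l * (x i / a) + (1 - l) * (y i / b))"
        proof -
          have "(a + b) * (l * (x i / a)) = x i" "(a + b) * ((1 - l) * (y i / b)) = y i"
            unfolding l' using 3 by (simp_all add: l_def)
          then show ?thesis by (simp add: distrib_left)
        qed
        then have "(x i + y i) powr p = (a + b) powr p * (l * (x i / a) + (1 - l) * (y i / b)) powr p"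
          using 3 l x[OF i] y[OF i] by (simp add: powr_mult)
        also have "(l * (x i / a) + (1 - l) * (y i / b)) powr p \<le> l * (x i / a) powr p + (1 - l) * (y i / b) powr p"
          using sum_mult_powr_le[of p "{True, False}" "\<lambda>t. if t then l else 1 - l" "\<lambda>t. if t then x i / a else y i / b"]
            p l 3 x[OF i] y[OF i] by simp
        finally show ?thesis by (simp add: mult_left_mono)
      qed
      then have "(\<Sum>i\<in>I. (x i + y i) powr p)
          \<le> (\<Sum>i\<in>I. (a + b) powr p * (l * (x i / a) powr p + (1 - l) * (y i / b) powr p))"
        by (rule sum_mono)
      also have "\<dots> = (a + b) powr p * (l * ((\<Sum>i\<in>I. x i powr p) / a powr p) + (1 - l) * ((\<Sum>i\<in>I. y i powr p) / b powr p))"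
        using 3 x y by (simp add: sum_distrib_left sum.distrib sum_divide_distrib distrib_left powr_divide)
      also have "\<dots> = (a + b) powr p"
        using 3 by (simp flip: ap bp)
      finally have "(\<Sum>i\<in>I. (x i + y i) powr p) powr (1 / p) \<le> ((a + b) powr p) powr (1 / p)"
        using p by (intro powr_mono2) (auto intro: sum_nonneg)
      then show ?thesis using 3 by (simp add: powr_powr a_def b_def)
    qed
  qed
qed

section \<open>The triangle inequality for the largest singular values\<close>

lemma square_powr_half: "0 \<le> t \<Longrightarrow> (t\<^sup>2) powr (q / 2) = t powr q" for t :: real
  by (cases "t = 0") (simp_all add: powr_powr flip: powr_numeral)

lemma svd_with_orthonormal_on:
  fixes M :: "real ^ 'n ^ 'm"
  assumes "svd_with s M u v" "k \<le> min CARD('m) CARD('n)"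
  shows "orthonormal_on {1..k} u" "orthonormal_on {1..k} v"
  using assms orthonormal_on_subset[of "{1..CARD('m)}" u "{1..k}"] orthonormal_on_subset[of "{1..CARD('n)}" v "{1..k}"]
  by (auto simp: svd_with_def orthonormal_basis_iff)

lemma svd_with_mult_right_vector:
  fixes M :: "real ^ 'n ^ 'm"
  assumes "svd_with s M u v" "i \<in> {1..min CARD('m) CARD('n)}"
  shows "M *v v i = s i *\<^sub>R u i"
proof -
  have v: "orthonormal_on {1..min CARD('m) CARD('n)} v"
    by (rule svd_with_orthonormal_on[OF assms(1)]) simp
  have "M *v v i = (\<Sum>j = 1..min CARD('m) CARD('n). if j = i then s i *\<^sub>R u i else 0)"
    unfolding svd_with_mult[OF assms(1)]
    by (rule sum.cong) (use orthonormal_on_inner[OF v _ assms(2)] in auto)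
  then show ?thesis using assms(2) by simp
qed

lemma svd_with_inner_mult:
  fixes M :: "real ^ 'n ^ 'm"
  assumes "svd_with s M u v" "i \<in> {1..min CARD('m) CARD('n)}"
  shows "u i \<bullet> (M *v x) = s i * (v i \<bullet> x)"
  using orthonormal_on_inner_sum[OF svd_with_orthonormal_on(1)[OF assms(1) order_refl] _ assms(2)]
  by (simp only: svd_with_mult[OF assms(1)] finite_atLeastAtMost)

text \<open>Among all weights in \<open>[0, 1]\<close> of total mass at most \<open>k\<close>, a weighted sum of a decreasing sequence is
  largest for the indicator \<open>e\<close> of the first \<open>k\<close> indices.\<close>

lemma sum_mult_le_sum_initial:
  fixes c \<tau> :: "nat \<Rightarrow> real"
  assumes k: "1 \<le> k" "k \<le> N"
    and anti: "\<And>i j. 1 \<le> i \<Longrightarrow> i \<le> j \<Longrightarrow> j \<le> N \<Longrightarrow> \<tau> j \<le> \<tau> i" and nonneg: "0 \<le> \<tau> k"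
    and c: "\<And>j. j \<in> {1..N} \<Longrightarrow> 0 \<le> c j" "\<And>j. j \<in> {1..N} \<Longrightarrow> c j \<le> 1" "(\<Sum>j = 1..N. c j) \<le> k"
  shows "(\<Sum>j = 1..N. c j * \<tau> j) \<le> (\<Sum>j = 1..k. \<tau> j)"
proof -
  define e where "e j = (if j \<le> k then 1 else 0 :: real)" for j
  have e: "(\<Sum>j = 1..N. e j * f j) = (\<Sum>j = 1..k. f j)" for f :: "nat \<Rightarrow> real"
  proof -
    have "(\<Sum>j = 1..N. e j * f j) = (\<Sum>j = 1..k. e j * f j)"
      by (rule sum.mono_neutral_right) (use k in \<open>auto simp: e_def\<close>)
    then show ?thesis by (simp add: e_def)
  qed
  have "(\<Sum>j = 1..N. (c j - e j) * (\<tau> j - \<tau> k)) \<le> 0"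
  proof (rule sum_nonpos)
    fix j assume j: "j \<in> {1..N}"
    show "(c j - e j) * (\<tau> j - \<tau> k) \<le> 0"
    proof (cases "j \<le> k")
      case True
      then show ?thesis using c(2)[OF j] anti[of j k] j k by (simp add: e_def mult_nonpos_nonneg)
    next
      case False
      then show ?thesis using c(1)[OF j] anti[of k j] j k by (simp add: e_def mult_nonneg_nonpos)
    qed
  qed
  moreover have "(\<Sum>j = 1..N. (c j - e j) * (\<tau> j - \<tau> k))
      = ((\<Sum>j = 1..N. c j * \<tau> j) - (\<Sum>j = 1..N. e j * \<tau> j)) - \<tau> k * ((\<Sum>j = 1..N. c j) - (\<Sum>j = 1..N. e j * 1))"
    by (simp add: algebra_simps sum.distrib sum_subtractf sum_distrib_left)
  moreover have "\<tau> k * ((\<Sum>j = 1..N. c j) - (\<Sum>j = 1..N. e j * 1)) \<le> 0"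
    using c(3) nonneg unfolding e by (simp add: mult_nonneg_nonpos)
  ultimately show ?thesis unfolding e by linarith
qed

text \<open>The variational bound behind the triangle inequality; equality holds for the singular vectors of
  \<open>X\<close>. The weights \<open>d i j\<close> form a doubly substochastic matrix by Bessel's inequality.\<close>

lemma sum_powr_inner_le:
  fixes X :: "real ^ 'n ^ 'm"
  assumes a: "orthonormal_on {1..k} a" and b: "orthonormal_on {1..k} b"
    and k: "1 \<le> k" "k \<le> min CARD('m) CARD('n)" and q: "1 \<le> q"
  shows "(\<Sum>i = 1..k. \<bar>a i \<bullet> (X *v b i)\<bar> powr q) \<le> (\<Sum>i = 1..k. singular_value X i powr q)"
proof -
  define N where "N = min CARD('m) CARD('n)"
  define \<sigma> where "\<sigma> = singular_value X"
  obtain u v where uv: "svd_with \<sigma> X u v" unfolding \<sigma>_def by (rule exists_svd)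
  have u: "orthonormal_on {1..N} u" and v: "orthonormal_on {1..N} v"
    using svd_with_orthonormal_on[OF uv] by (auto simp: N_def)
  have \<sigma>: "0 \<le> \<sigma> j" if "j \<in> {1..N}" for j
    using singular_value_nonneg[of j X] that by (simp add: \<sigma>_def N_def)
  define d where "d i j = ((u j \<bullet> a i)\<^sup>2 + (v j \<bullet> b i)\<^sup>2) / 2" for i j
  have d: "0 \<le> d i j" for i j by (simp add: d_def)
  have row: "(\<Sum>j = 1..N. d i j) \<le> 1" if i: "i \<in> {1..k}" for i
    using bessel_inequality[OF u, of "a i"] bessel_inequality[OF v, of "b i"]
      orthonormal_on_norm[OF a i] orthonormal_on_norm[OF b i]
    by (simp add: d_def sum.distrib sum_divide_distrib[symmetric])
  have col: "(\<Sum>i = 1..k. d i j) \<le> 1" if j: "j \<in> {1..N}" for j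
    using bessel_inequality[OF a, of "u j"] bessel_inequality[OF b, of "v j"]
      orthonormal_on_norm[OF u j] orthonormal_on_norm[OF v j]
    by (simp add: d_def sum.distrib sum_divide_distrib[symmetric] inner_commute)
  have "\<bar>a i \<bullet> (X *v b i)\<bar> powr q \<le> (\<Sum>j = 1..N. d i j * \<sigma> j powr q)" if i: "i \<in> {1..k}" for i
  proof -
    have "\<bar>a i \<bullet> (X *v b i)\<bar> = \<bar>\<Sum>j = 1..N. \<sigma> j * (v j \<bullet> b i) * (a i \<bullet> u j)\<bar>"
      unfolding svd_with_mult[OF uv] by (simp add: inner_sum_right N_def)
    also have "\<dots> \<le> (\<Sum>j = 1..N. d i j * \<sigma> j)"
    proof (rule order_trans[OF sum_abs sum_mono])
      fix j assume j: "j \<in> {1..N}"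
      have "2 * (\<bar>u j \<bullet> a i\<bar> * \<bar>v j \<bullet> b i\<bar>) \<le> (u j \<bullet> a i)\<^sup>2 + (v j \<bullet> b i)\<^sup>2"
        using sum_squares_bound[of "\<bar>u j \<bullet> a i\<bar>" "\<bar>v j \<bullet> b i\<bar>"] by (simp add: mult.assoc)
      then have "\<bar>u j \<bullet> a i\<bar> * \<bar>v j \<bullet> b i\<bar> \<le> d i j" by (simp add: d_def)
      then have "(\<bar>u j \<bullet> a i\<bar> * \<bar>v j \<bullet> b i\<bar>) * \<sigma> j \<le> d i j * \<sigma> j"
        by (rule mult_right_mono[OF _ \<sigma>[OF j]])
      then show "\<bar>\<sigma> j * (v j \<bullet> b i) * (a i \<bullet> u j)\<bar> \<le> d i j * \<sigma> j"
        using \<sigma>[OF j] by (simp add: abs_mult inner_commute mult_ac)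
    qed
    finally have "\<bar>a i \<bullet> (X *v b i)\<bar> powr q \<le> (\<Sum>j = 1..N. d i j * \<sigma> j) powr q"
      using q by (intro powr_mono2) auto
    also have "\<dots> \<le> (\<Sum>j = 1..N. d i j * \<sigma> j powr q)"
      using q d row[OF i] \<sigma> by (intro sum_mult_powr_le) auto
    finally show ?thesis .
  qed
  then have "(\<Sum>i = 1..k. \<bar>a i \<bullet> (X *v b i)\<bar> powr q) \<le> (\<Sum>i = 1..k. \<Sum>j = 1..N. d i j * \<sigma> j powr q)"
    by (rule sum_mono)
  also have "\<dots> = (\<Sum>j = 1..N. (\<Sum>i = 1..k. d i j) * \<sigma> j powr q)"
    by (subst sum.swap) (simp add: sum_distrib_right)
  also have "\<dots> \<le> (\<Sum>j = 1..k. \<sigma> j powr q)"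
  proof (rule sum_mult_le_sum_initial)
    show "\<sigma> j powr q \<le> \<sigma> i powr q" if "1 \<le> i" "i \<le> j" "j \<le> N" for i j
      using q that singular_value_antimono[of i j X] \<sigma>[of j] by (intro powr_mono2) (auto simp: \<sigma>_def N_def)
    have "(\<Sum>j = 1..N. \<Sum>i = 1..k. d i j) = (\<Sum>i = 1..k. \<Sum>j = 1..N. d i j)" by (rule sum.swap)
    also have "\<dots> \<le> (\<Sum>i = 1..k. 1)" using row by (rule sum_mono)
    finally show "(\<Sum>j = 1..N. \<Sum>i = 1..k. d i j) \<le> real k" by simp
  qed (use k d col in \<open>auto simp: N_def intro: sum_nonneg\<close>)
  finally show ?thesis by (simp add: \<sigma>_def)
qed

text \<open>The \<open>q\<close>-norm of the \<open>k\<close> largest singular values, that is, the Schatten norm of a best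
  approximation of rank at most \<open>k\<close>; meaningful for \<open>k \<le> min m n\<close>.\<close>

definition truncated_norm :: "real \<Rightarrow> nat \<Rightarrow> real ^ 'n ^ 'm \<Rightarrow> real"
  where "truncated_norm q k M = (\<Sum>i = 1..k. singular_value M i powr q) powr (1 / q)"

lemma schatten_norm_eq_truncated:
  "schatten_norm q (M :: real ^ 'n ^ 'm) = truncated_norm q (min CARD('m) CARD('n)) M"
  by (simp add: schatten_norm_def truncated_norm_def)

lemma truncated_norm_powr:
  assumes "0 < q"
  shows "truncated_norm q k M powr q = (\<Sum>i = 1..k. singular_value M i powr q)"
  using assms by (simp add: truncated_norm_def powr_powr sum_nonneg)

lemma truncated_norm_triangle:
  fixes X Y :: "real ^ 'n ^ 'm"
  assumes k: "1 \<le> k" "k \<le> min CARD('m) CARD('n)" and q: "1 \<le> q"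
  shows "truncated_norm q k (X + Y) \<le> truncated_norm q k X + truncated_norm q k Y"
proof -
  obtain u v where uv: "svd_with (singular_value (X + Y)) (X + Y) u v" by (rule exists_svd)
  note on = svd_with_orthonormal_on[OF uv k(2)]
  have "singular_value (X + Y) i \<le> \<bar>u i \<bullet> (X *v v i)\<bar> + \<bar>u i \<bullet> (Y *v v i)\<bar>" if i: "i \<in> {1..k}" for i
  proof -
    have iN: "i \<in> {1..min CARD('m) CARD('n)}" using i k by auto
    have "singular_value (X + Y) i = u i \<bullet> ((X + Y) *v v i)"
      using svd_with_inner_mult[OF uv iN, of "v i"] orthonormal_on_inner[OF on(2) i i] by simp
    then show ?thesis by (simp add: matrix_vector_mult_add_rdistrib inner_add_right)
  qed
  moreover have "0 \<le> singular_value (X + Y) i" if "i \<in> {1..k}" for i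
    using that k by (intro singular_value_nonneg) auto
  ultimately have "truncated_norm q k (X + Y)
      \<le> (\<Sum>i = 1..k. (\<bar>u i \<bullet> (X *v v i)\<bar> + \<bar>u i \<bullet> (Y *v v i)\<bar>) powr q) powr (1 / q)"
    unfolding truncated_norm_def using q by (intro powr_mono2 sum_mono) (auto intro: sum_nonneg)
  also have "\<dots> \<le> (\<Sum>i = 1..k. \<bar>u i \<bullet> (X *v v i)\<bar> powr q) powr (1 / q)
      + (\<Sum>i = 1..k. \<bar>u i \<bullet> (Y *v v i)\<bar> powr q) powr (1 / q)"
    using q by (intro minkowski_inequality_sum) auto
  also have "\<dots> \<le> truncated_norm q k X + truncated_norm q k Y"
    unfolding truncated_norm_def using q
    by (intro add_mono powr_mono2 sum_powr_inner_le[OF on k]) (auto intro: sum_nonneg)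
  finally show ?thesis .
qed

lemma truncated_norm_mono:
  fixes X Y :: "real ^ 'n ^ 'm"
  assumes "k \<le> min CARD('m) CARD('n)" "0 < q"
    and "\<And>i. i \<in> {1..k} \<Longrightarrow> singular_value X i \<le> singular_value Y i"
  shows "truncated_norm q k X \<le> truncated_norm q k Y"
  unfolding truncated_norm_def
  using assms singular_value_nonneg[of _ X]
  by (intro powr_mono2 sum_mono) (auto intro: sum_nonneg)

lemma schatten_norm_eq_truncated_if_zero:
  fixes X :: "real ^ 'n ^ 'm"
  assumes "k \<le> min CARD('m) CARD('n)"
    and "\<And>i. k < i \<Longrightarrow> i \<le> min CARD('m) CARD('n) \<Longrightarrow> singular_value X i = 0"
  shows "schatten_norm q X = truncated_norm q k X"
  unfolding schatten_norm_def truncated_norm_def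
  by (rule arg_cong[of _ _ "\<lambda>s. s powr (1 / q)"], rule sum.mono_neutral_right) (use assms in auto)

section \<open>Schatten norms of sums with orthogonal ranges\<close>

lemma norm_add_orthogonal_range:
  fixes X Y :: "real ^ 'n ^ 'm"
  assumes "\<And>x y. (X *v x) \<bullet> (Y *v y) = 0"
  shows "(norm ((X + Y) *v x))\<^sup>2 = (norm (X *v x))\<^sup>2 + (norm (Y *v x))\<^sup>2"
  using assms[of x x]
  by (simp add: matrix_vector_mult_add_rdistrib power2_norm_eq_inner inner_add_left inner_add_right inner_commute)

text \<open>The share of \<open>X\<close> in the Schatten sum of \<open>X + Y\<close>. Since \<open>(norm (X *v v i))\<^sup>2\<close> and \<open>(norm (Y *v v i))\<^sup>2\<close> add up
  to \<open>(\<sigma> i)\<^sup>2\<close>, the shares of \<open>X\<close> and \<open>Y\<close> add up to the whole Schatten sum. The bound is Jensen's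
  inequality for the concave function \<open>x powr (q / 2)\<close>, applied to \<open>(\<sigma> i)\<^sup>2\<close> with weights
  \<open>(u i \<bullet> a j)\<^sup>2\<close>, where \<open>a j\<close> runs through the left singular vectors of \<open>X\<close> with nonzero singular value. Where
  \<open>\<sigma> i = 0\<close>, the quotient is 0 by the convention for division by 0.\<close>

lemma sum_powr_le_of_orthogonal_range:
  fixes X Y :: "real ^ 'n ^ 'm"
  assumes orth: "\<And>x y. (X *v x) \<bullet> (Y *v y) = 0" and q: "0 < q" "q \<le> 2"
    and uv: "svd_with \<sigma> (X + Y) u v"
  shows "(\<Sum>i = 1..min CARD('m) CARD('n). \<sigma> i powr q * ((norm (X *v v i))\<^sup>2 / (\<sigma> i)\<^sup>2))
    \<le> (\<Sum>i = 1..min CARD('m) CARD('n). singular_value X i powr q)"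
proof -
  define N where "N = min CARD('m) CARD('n)"
  define \<tau> where "\<tau> = singular_value X"
  obtain a b where ab: "svd_with \<tau> X a b" unfolding \<tau>_def by (rule exists_svd)
  have u: "orthonormal_on {1..N} u" and a: "orthonormal_on {1..N} a" and b: "orthonormal_on {1..N} b"
    using svd_with_orthonormal_on[OF uv] svd_with_orthonormal_on[OF ab] by (auto simp: N_def)
  have \<tau>: "0 \<le> \<tau> j" if "j \<in> {1..N}" for j
    using singular_value_nonneg[of j X] that by (simp add: \<tau>_def N_def)
  have \<sigma>: "0 \<le> \<sigma> j" if "j \<in> {1..N}" for j
    using uv that by (simp add: svd_with_def N_def)
  define J where "J = {j \<in> {1..N}. \<tau> j \<noteq> 0}"
  have J: "J \<subseteq> {1..N}" "finite J" by (auto simp: J_def)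
  \<comment> \<open>For \<open>j \<in> J\<close> the vector \<open>a j\<close> lies in the range of \<open>X\<close>.\<close>
  have aY: "a j \<bullet> (Y *v y) = 0" if "j \<in> J" for j y
  proof -
    have "j \<in> {1..min CARD('m) CARD('n)}" using that by (auto simp: J_def N_def)
    from svd_with_mult_right_vector[OF ab this] have "\<tau> j * (a j \<bullet> (Y *v y)) = 0"
      using orth[of "b j" y] by simp
    then show ?thesis using that by (simp add: J_def)
  qed
  have split: "\<sigma> i powr q * ((norm (X *v v i))\<^sup>2 / (\<sigma> i)\<^sup>2) \<le> (\<Sum>j\<in>J. \<sigma> i powr q * (u i \<bullet> a j)\<^sup>2)"
    if i: "i \<in> {1..N}" for i
  proof -
    have "(norm (X *v v i))\<^sup>2 = (\<Sum>j = 1..N. (\<tau> j * (b j \<bullet> v i))\<^sup>2)"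
      using svd_with_norm[OF ab] by (simp add: N_def power_mult_distrib)
    also have "\<dots> = (\<Sum>j\<in>J. (\<tau> j * (b j \<bullet> v i))\<^sup>2)"
      by (rule sum.mono_neutral_right) (auto simp: J_def)
    also have "\<dots> = (\<Sum>j\<in>J. (\<sigma> i * (u i \<bullet> a j))\<^sup>2)"
    proof (rule sum.cong[OF refl])
      fix j assume j: "j \<in> J"
      have "\<tau> j * (b j \<bullet> v i) = a j \<bullet> (X *v v i)"
        using svd_with_inner_mult[OF ab, of j] j J by (auto simp: N_def)
      also have "\<dots> = a j \<bullet> ((X + Y) *v v i)"
        using aY[OF j] by (simp add: matrix_vector_mult_add_rdistrib inner_add_right)
      also have "\<dots> = \<sigma> i * (u i \<bullet> a j)"
        using svd_with_mult_right_vector[OF uv, of i] i by (simp add: N_def inner_commute)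
      finally show "(\<tau> j * (b j \<bullet> v i))\<^sup>2 = (\<sigma> i * (u i \<bullet> a j))\<^sup>2" by simp
    qed
    finally have "(norm (X *v v i))\<^sup>2 = (\<sigma> i)\<^sup>2 * (\<Sum>j\<in>J. (u i \<bullet> a j)\<^sup>2)"
      by (simp add: power_mult_distrib sum_distrib_left)
    then show ?thesis
      by (cases "\<sigma> i = 0") (simp_all flip: sum_distrib_left)
  qed
  have col: "(\<Sum>i = 1..N. \<sigma> i powr q * (u i \<bullet> a j)\<^sup>2) \<le> \<tau> j powr q" if j: "j \<in> J" for j
  proof -
    have jN: "j \<in> {1..N}" using j J by auto
    have "transpose (X + Y) *v a j = \<tau> j *\<^sub>R b j"
    proof (rule vector_eq_ldot[THEN iffD1, rule_format])
      fix x
      have "x \<bullet> (transpose (X + Y) *v a j) = a j \<bullet> ((X + Y) *v x)"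
        by (metis dot_lmul_matrix inner_commute transpose_matrix_vector)
      also have "\<dots> = a j \<bullet> (X *v x)"
        using aY[OF j] by (simp add: matrix_vector_mult_add_rdistrib inner_add_right)
      also have "\<dots> = x \<bullet> (\<tau> j *\<^sub>R b j)"
        using svd_with_inner_mult[OF ab, of j] jN by (simp add: N_def inner_commute)
      finally show "x \<bullet> (transpose (X + Y) *v a j) = x \<bullet> (\<tau> j *\<^sub>R b j)" .
    qed
    then have "(norm (transpose (X + Y) *v a j))\<^sup>2 = (\<tau> j)\<^sup>2"
      using orthonormal_on_norm[OF b jN] by simp
    then have \<tau>sq: "(\<tau> j)\<^sup>2 = (\<Sum>i = 1..N. (u i \<bullet> a j)\<^sup>2 * (\<sigma> i)\<^sup>2)"
      using svd_with_norm[OF svd_with_transpose[OF uv]] by (simp add: N_def min.commute mult.commute)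
    have "(\<Sum>i = 1..N. \<sigma> i powr q * (u i \<bullet> a j)\<^sup>2) = (\<Sum>i = 1..N. (u i \<bullet> a j)\<^sup>2 * ((\<sigma> i)\<^sup>2) powr (q / 2))"
      by (rule sum.cong) (use \<sigma> in \<open>auto simp: square_powr_half\<close>)
    also have "\<dots> \<le> (\<Sum>i = 1..N. (u i \<bullet> a j)\<^sup>2 * (\<sigma> i)\<^sup>2) powr (q / 2)"
      using q bessel_inequality[OF u, of "a j"] orthonormal_on_norm[OF a jN]
      by (intro sum_mult_powr_ge) auto
    also have "\<dots> = \<tau> j powr q"
      unfolding \<tau>sq[symmetric] by (rule square_powr_half[OF \<tau>[OF jN]])
    finally show ?thesis .
  qed
  have "(\<Sum>i = 1..N. \<sigma> i powr q * ((norm (X *v v i))\<^sup>2 / (\<sigma> i)\<^sup>2))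
      \<le> (\<Sum>i = 1..N. \<Sum>j\<in>J. \<sigma> i powr q * (u i \<bullet> a j)\<^sup>2)"
    by (rule sum_mono[OF split])
  also have "\<dots> = (\<Sum>j\<in>J. \<Sum>i = 1..N. \<sigma> i powr q * (u i \<bullet> a j)\<^sup>2)"
    by (rule sum.swap)
  also have "\<dots> \<le> (\<Sum>j\<in>J. \<tau> j powr q)"
    by (rule sum_mono[OF col])
  also have "\<dots> \<le> (\<Sum>j = 1..N. \<tau> j powr q)"
    using J by (intro sum_mono2) auto
  finally show ?thesis by (simp add: \<tau>_def N_def)
qed

lemma schatten_norm_add_le_2:
  fixes X Y :: "real ^ 'n ^ 'm"
  assumes orth: "\<And>x y. (X *v x) \<bullet> (Y *v y) = 0" and q: "0 < q" "q \<le> 2"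
  shows "schatten_norm q (X + Y) powr q \<le> schatten_norm q X powr q + schatten_norm q Y powr q"
proof -
  define N where "N = min CARD('m) CARD('n)"
  define \<sigma> where "\<sigma> = singular_value (X + Y)"
  obtain u v where uv: "svd_with \<sigma> (X + Y) u v" unfolding \<sigma>_def by (rule exists_svd)
  have v: "orthonormal_on {1..N} v" and u: "orthonormal_on {1..N} u"
    using svd_with_orthonormal_on[OF uv] by (auto simp: N_def)
  have orth': "(Y *v x) \<bullet> (X *v y) = 0" for x y
    using orth[of y x] by (simp add: inner_commute)
  have vu: "svd_with \<sigma> (Y + X) u v" using uv by (simp add: add.commute)
  have "\<sigma> i powr q = \<sigma> i powr q * ((norm (X *v v i))\<^sup>2 / (\<sigma> i)\<^sup>2) + \<sigma> i powr q * ((norm (Y *v v i))\<^sup>2 / (\<sigma> i)\<^sup>2)"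
    if i: "i \<in> {1..N}" for i
  proof -
    have "(norm (X *v v i))\<^sup>2 + (norm (Y *v v i))\<^sup>2 = (\<sigma> i)\<^sup>2"
      using svd_with_mult_right_vector[OF uv, of i] norm_add_orthogonal_range[OF orth, of "v i"] i
        orthonormal_on_norm[OF u i] by (simp add: N_def)
    then show ?thesis
      by (cases "\<sigma> i = 0") (simp_all add: distrib_left[symmetric] add_divide_distrib[symmetric])
  qed
  then have "(\<Sum>i = 1..N. \<sigma> i powr q) = (\<Sum>i = 1..N. \<sigma> i powr q * ((norm (X *v v i))\<^sup>2 / (\<sigma> i)\<^sup>2))
      + (\<Sum>i = 1..N. \<sigma> i powr q * ((norm (Y *v v i))\<^sup>2 / (\<sigma> i)\<^sup>2))"
    by (simp flip: sum.distrib)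
  also have "\<dots> \<le> (\<Sum>i = 1..N. singular_value X i powr q) + (\<Sum>i = 1..N. singular_value Y i powr q)"
    using sum_powr_le_of_orthogonal_range[OF orth q uv] sum_powr_le_of_orthogonal_range[OF orth' q vu]
    by (simp add: N_def)
  finally show ?thesis
    using q(1) by (simp add: schatten_norm_eq_truncated truncated_norm_powr \<sigma>_def N_def)
qed

text \<open>For exponents at least 2 Jensen's inequality is the convex one, with weights \<open>(b j \<bullet> v i)\<^sup>2\<close> for the
  right singular vectors \<open>b j\<close> of \<open>X\<close>.\<close>

lemma sum_norm_powr_le:
  fixes X :: "real ^ 'n ^ 'm"
  assumes v: "orthonormal_on {1..k} v" and q: "2 \<le> q"
  shows "(\<Sum>i = 1..k. ((norm (X *v v i))\<^sup>2) powr (q / 2))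
    \<le> (\<Sum>i = 1..min CARD('m) CARD('n). singular_value X i powr q)"
proof -
  define N where "N = min CARD('m) CARD('n)"
  define \<tau> where "\<tau> = singular_value X"
  obtain a b where ab: "svd_with \<tau> X a b" unfolding \<tau>_def by (rule exists_svd)
  have b: "orthonormal_on {1..N} b"
    using svd_with_orthonormal_on[OF ab] by (auto simp: N_def)
  have \<tau>: "0 \<le> \<tau> j" if "j \<in> {1..N}" for j
    using singular_value_nonneg[of j X] that by (simp add: \<tau>_def N_def)
  have "((norm (X *v v i))\<^sup>2) powr (q / 2) \<le> (\<Sum>j = 1..N. (b j \<bullet> v i)\<^sup>2 * \<tau> j powr q)" if i: "i \<in> {1..k}" for i
  proof -
    have "((norm (X *v v i))\<^sup>2) powr (q / 2) = (\<Sum>j = 1..N. (b j \<bullet> v i)\<^sup>2 * (\<tau> j)\<^sup>2) powr (q / 2)"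
      using svd_with_norm[OF ab, of "v i"] by (simp add: N_def mult.commute)
    also have "\<dots> \<le> (\<Sum>j = 1..N. (b j \<bullet> v i)\<^sup>2 * ((\<tau> j)\<^sup>2) powr (q / 2))"
      using q bessel_inequality[OF b, of "v i"] orthonormal_on_norm[OF v i]
      by (intro sum_mult_powr_le) auto
    also have "\<dots> = (\<Sum>j = 1..N. (b j \<bullet> v i)\<^sup>2 * \<tau> j powr q)"
      by (rule sum.cong) (use \<tau> in \<open>auto simp: square_powr_half\<close>)
    finally show ?thesis .
  qed
  then have "(\<Sum>i = 1..k. ((norm (X *v v i))\<^sup>2) powr (q / 2)) \<le> (\<Sum>i = 1..k. \<Sum>j = 1..N. (b j \<bullet> v i)\<^sup>2 * \<tau> j powr q)"
    by (rule sum_mono)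
  also have "\<dots> = (\<Sum>j = 1..N. (\<Sum>i = 1..k. (v i \<bullet> b j)\<^sup>2) * \<tau> j powr q)"
    by (subst sum.swap) (simp add: sum_distrib_right inner_commute)
  also have "\<dots> \<le> (\<Sum>j = 1..N. 1 * \<tau> j powr q)"
  proof (intro sum_mono mult_right_mono)
    fix j assume "j \<in> {1..N}"
    then show "(\<Sum>i = 1..k. (v i \<bullet> b j)\<^sup>2) \<le> 1"
      using bessel_inequality[OF v, of "b j"] orthonormal_on_norm[OF b] by simp
  qed simp
  finally show ?thesis by (simp add: \<tau>_def N_def)
qed

text \<open>By Pythagoras, the squared singular values of \<open>X + Y\<close> split into two summands, to which Minkowski's
  inequality with exponent \<open>q / 2\<close> applies.\<close>

lemma schatten_norm_add_ge_2:
  fixes X Y :: "real ^ 'n ^ 'm"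
  assumes orth: "\<And>x y. (X *v x) \<bullet> (Y *v y) = 0" and q: "2 \<le> q"
  shows "(schatten_norm q (X + Y))\<^sup>2 \<le> (schatten_norm q X)\<^sup>2 + (schatten_norm q Y)\<^sup>2"
proof -
  define N where "N = min CARD('m) CARD('n)"
  define \<sigma> where "\<sigma> = singular_value (X + Y)"
  obtain u v where uv: "svd_with \<sigma> (X + Y) u v" unfolding \<sigma>_def by (rule exists_svd)
  have v: "orthonormal_on {1..N} v" and u: "orthonormal_on {1..N} u"
    using svd_with_orthonormal_on[OF uv] by (auto simp: N_def)
  have schatten_sq: "(schatten_norm q M)\<^sup>2 = (\<Sum>i = 1..N. singular_value M i powr q) powr (1 / (q / 2))"
    for M :: "real ^ 'n ^ 'm"
    using q by (simp add: schatten_norm_def N_def powr_powr power2_eq_square flip: powr_add)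
  have "\<sigma> i powr q = ((norm (X *v v i))\<^sup>2 + (norm (Y *v v i))\<^sup>2) powr (q / 2)" if i: "i \<in> {1..N}" for i
  proof -
    have "0 \<le> \<sigma> i" using uv i by (simp add: svd_with_def N_def)
    moreover have "(norm (X *v v i))\<^sup>2 + (norm (Y *v v i))\<^sup>2 = (\<sigma> i)\<^sup>2"
      using svd_with_mult_right_vector[OF uv, of i] norm_add_orthogonal_range[OF orth, of "v i"] i
        orthonormal_on_norm[OF u i] by (simp add: N_def)
    ultimately show ?thesis by (simp add: square_powr_half)
  qed
  then have "(schatten_norm q (X + Y))\<^sup>2
      = (\<Sum>i = 1..N. ((norm (X *v v i))\<^sup>2 + (norm (Y *v v i))\<^sup>2) powr (q / 2)) powr (1 / (q / 2))"
    by (simp add: schatten_sq \<sigma>_def)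
  also have "\<dots> \<le> (\<Sum>i = 1..N. ((norm (X *v v i))\<^sup>2) powr (q / 2)) powr (1 / (q / 2))
      + (\<Sum>i = 1..N. ((norm (Y *v v i))\<^sup>2) powr (q / 2)) powr (1 / (q / 2))"
    using q by (intro minkowski_inequality_sum) auto
  also have "\<dots> \<le> (schatten_norm q X)\<^sup>2 + (schatten_norm q Y)\<^sup>2"
    unfolding schatten_sq using q sum_norm_powr_le[OF v q, of X] sum_norm_powr_le[OF v q, of Y]
    by (intro add_mono powr_mono2) (auto simp: N_def intro: sum_nonneg)
  finally show ?thesis .
qed

section \<open>Truncated decompositions and projections\<close>

lemma svd_with_truncation:
  fixes M :: "real ^ 'n ^ 'm"
  assumes uv: "svd_with s M u v" and r: "r \<le> min CARD('m) CARD('n)"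
    and i: "i \<in> {1..min CARD('m) CARD('n)}"
  shows "singular_value (\<Sum>j = 1..r. s j *\<^sub>R outer_prod (u j) (v j)) i = (if i \<le> r then s i else 0)"
proof -
  define N where "N = min CARD('m) CARD('n)"
  define t where "t j = (if j \<le> r then s j else 0)" for j
  have "(\<Sum>j = 1..r. s j *\<^sub>R outer_prod (u j) (v j)) = (\<Sum>j = 1..N. t j *\<^sub>R outer_prod (u j) (v j))"
    by (rule sum.mono_neutral_cong_left) (use r in \<open>auto simp: t_def N_def\<close>)
  then have "svd_with t (\<Sum>j = 1..r. s j *\<^sub>R outer_prod (u j) (v j)) u v"
    using uv by (auto simp: svd_with_def t_def N_def)
  from svd_with_singular_value[OF this i] show ?thesis by (simp add: t_def)
qed

text \<open>The remainder after truncation has the decomposition obtained by moving the first \<open>r\<close> pairs of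
  singular vectors, which now belong to the singular value 0, behind the others.\<close>

lemma svd_with_remainder:
  fixes M :: "real ^ 'n ^ 'm"
  assumes uv: "svd_with s M u v" and r: "r \<le> min CARD('m) CARD('n)"
    and i: "i \<in> {1..min CARD('m) CARD('n)}"
  shows "singular_value (M - (\<Sum>j = 1..r. s j *\<^sub>R outer_prod (u j) (v j))) i =
    (if r + i \<le> min CARD('m) CARD('n) then s (r + i) else 0)"
proof -
  define N where "N = min CARD('m) CARD('n)"
  have rN: "r \<le> N" and N: "N \<le> CARD('m)" "N \<le> CARD('n)" using r by (auto simp: N_def)
  define \<pi> where "\<pi> j = (if j \<le> N - r then r + j else if j \<le> N then j - (N - r) else j)" for j
  define t where "t j = (if r + j \<le> N then s (r + j) else 0)" for j
  have \<pi>: "\<pi> j \<in> {1..K}" if "j \<in> {1..K}" "N \<le> K" for j K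
    using that rN by (auto simp: \<pi>_def)
  have inj: "inj_on \<pi> {1..K}" for K
    using rN by (auto simp: inj_on_def \<pi>_def split: if_splits)
  have basis: "orthonormal_basis (w \<circ> \<pi>)" if "orthonormal_basis w" "N \<le> CARD('k)"
    for w :: "nat \<Rightarrow> real ^ 'k"
    unfolding orthonormal_basis_iff
    by (rule orthonormal_on_comp[OF _ inj]) (use that \<pi>[OF _ that(2)] in \<open>auto simp: orthonormal_basis_iff\<close>)
  have bij: "bij_betw \<pi> {1..N} {1..N}"
  proof -
    have "\<pi> ` {1..N} \<subseteq> {1..N}" using \<pi>[OF _ order_refl] by blast
    then show ?thesis
      unfolding bij_betw_def using inj endo_inj_surj[of "{1..N}" \<pi>] by blast
  qed
  let ?f = "\<lambda>j. s j *\<^sub>R outer_prod (u j) (v j)"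
  have "M - (\<Sum>j = 1..r. ?f j) = (\<Sum>j = 1..N. if r < j then ?f j else 0)"
  proof -
    have "M = (\<Sum>j = 1..N. ?f j)" using uv unfolding svd_with_def N_def by blast
    also have "\<dots> = (\<Sum>j = 1..r. ?f j) + (\<Sum>j \<in> {1..N} - {1..r}. ?f j)"
      using sum.subset_diff[of "{1..r}" "{1..N}" ?f] rN by (simp add: add.commute)
    also have "(\<Sum>j \<in> {1..N} - {1..r}. ?f j) = (\<Sum>j = 1..N. if r < j then ?f j else 0)"
      by (rule sum.mono_neutral_cong_left) auto
    finally show ?thesis by simp
  qed
  also have "\<dots> = (\<Sum>j = 1..N. if r < \<pi> j then ?f (\<pi> j) else 0)"
    by (rule sum.reindex_bij_betw[OF bij, symmetric])
  also have "\<dots> = (\<Sum>j = 1..N. t j *\<^sub>R outer_prod ((u \<circ> \<pi>) j) ((v \<circ> \<pi>) j))"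
    by (rule sum.cong) (use rN in \<open>auto simp: t_def \<pi>_def\<close>)
  finally have eq: "M - (\<Sum>j = 1..r. ?f j) = (\<Sum>j = 1..N. t j *\<^sub>R outer_prod ((u \<circ> \<pi>) j) ((v \<circ> \<pi>) j))" .
  have "\<forall>j\<in>{1..N}. 0 \<le> t j" "\<forall>j\<in>{1..N}. \<forall>k\<in>{1..N}. j \<le> k \<longrightarrow> t k \<le> t j"
    using uv by (auto simp: svd_with_def t_def N_def)
  then have "svd_with t (M - (\<Sum>j = 1..r. ?f j)) (u \<circ> \<pi>) (v \<circ> \<pi>)"
    using eq basis[of u] basis[of v] uv N unfolding svd_with_def N_def by blast
  from svd_with_singular_value[OF this i] show ?thesis by (simp add: t_def N_def)
qed

text \<open>For an orthonormal family \<open>u\<close>, the matrix of the orthogonal projection to the span of its first \<open>r\<close>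
  vectors.\<close>

definition proj_matrix :: "nat \<Rightarrow> (nat \<Rightarrow> real ^ 'm) \<Rightarrow> real ^ 'm ^ 'm"
  where "proj_matrix r u = (\<Sum>j = 1..r. outer_prod (u j) (u j))"

lemma proj_matrix_mult_vec: "proj_matrix r u *v y = (\<Sum>j = 1..r. (u j \<bullet> y) *\<^sub>R u j)"
  by (simp add: proj_matrix_def sum_matrix_vec outer_prod_mult_vec)

lemma norm_proj_matrix_le:
  assumes "orthonormal_on {1..r} u"
  shows "norm (proj_matrix r u *v y) \<le> norm y"
    and "norm (y - proj_matrix r u *v y) \<le> norm y"
proof -
  have "(norm (proj_matrix r u *v y))\<^sup>2 \<le> (norm y)\<^sup>2"
    using orthonormal_on_norm_sum[OF assms] bessel_inequality[OF assms, of y] by (simp add: proj_matrix_mult_vec)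
  then show "norm (proj_matrix r u *v y) \<le> norm y" by (rule power2_le_imp_le) simp
  have "(norm (y - proj_matrix r u *v y))\<^sup>2 \<le> (norm y)\<^sup>2"
    using orthonormal_on_pythagoras[OF assms, of y] by (simp add: proj_matrix_mult_vec sum_nonneg)
  then show "norm (y - proj_matrix r u *v y) \<le> norm y" by (rule power2_le_imp_le) simp
qed

lemma proj_matrix_orthogonal:
  assumes "orthonormal_on {1..r} u"
  shows "(proj_matrix r u *v y) \<bullet> (proj_matrix r u *v z - z) = 0"
proof -
  have "u j \<bullet> (proj_matrix r u *v z - z) = 0" if "j \<in> {1..r}" for j
    using orthonormal_on_inner_sum[OF assms _ that] unfolding proj_matrix_mult_vec inner_diff_right by simp
  then show ?thesis
    unfolding proj_matrix_mult_vec[of r u y] inner_sum_left by simp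
qed

lemma rank_proj_matrix_le: "rank (proj_matrix r u) \<le> r"
proof -
  have "dim (range (\<lambda>y. proj_matrix r u *v y)) \<le> dim (span (u ` {1..r}))"
    unfolding proj_matrix_mult_vec
    by (intro dim_subset image_subsetI span_sum span_mul) (auto intro: span_base)
  also have "\<dots> \<le> card (u ` {1..r})" by (simp add: dim_le_card' dim_span)
  also have "\<dots> \<le> r" using card_image_le[of "{1..r}" u] by simp
  finally show ?thesis by (simp add: rank_dim_range)
qed

lemma schatten_norm_nonneg: "0 \<le> schatten_norm q M"
  by (simp add: schatten_norm_def)

section \<open>The perturbation bound\<close>

theorem theorem1:
  fixes A Z B A_hat Z_max :: "real ^ 'n ^ 'm" and r :: nat
  assumes "1 \<le> r" and "r \<le> min CARD('m) CARD('n)"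
    and "B = A + Z"
    and "rank A = r"
    and "is_truncated_svd r B A_hat"
    and "is_truncated_svd r Z Z_max"
  shows "(\<forall>q::real. 1 \<le> q \<and> q \<le> 2 \<longrightarrow>
            schatten_norm q (A_hat - A) \<le> (2 powr q + 1) powr (1 / q) * schatten_norm q Z_max)
       \<and> (\<forall>q::real. 2 \<le> q \<longrightarrow>
            schatten_norm q (A_hat - A) \<le> sqrt 5 * schatten_norm q Z_max)
       \<and> spectral_norm (A_hat - A) \<le> 2 * spectral_norm Z_max"
proof -
  define N where "N = min CARD('m) CARD('n)"
  note r = assms(1,2)
  obtain u v where uv: "svd_with (singular_value B) B u v"
    and A_hat: "A_hat = (\<Sum>i = 1..r. singular_value B i *\<^sub>R outer_prod (u i) (v i))"
    using assms(5) by (auto simp: is_truncated_svd_def is_svd_iff_svd_with)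
  obtain y z where yz: "svd_with (singular_value Z) Z y z"
    and Z_max: "Z_max = (\<Sum>i = 1..r. singular_value Z i *\<^sub>R outer_prod (y i) (z i))"
    using assms(6) by (auto simp: is_truncated_svd_def is_svd_iff_svd_with)
  have sv_Z_max: "singular_value Z_max i = (if i \<le> r then singular_value Z i else 0)" if "i \<in> {1..N}" for i
    using svd_with_truncation[OF yz r(2)] that by (simp add: Z_max N_def)
  have u: "orthonormal_on {1..r} u" by (rule svd_with_orthonormal_on[OF uv r(2)])
  define P where "P = proj_matrix r u"
  have A_hat_proj: "A_hat = P ** B"
  proof -
    have "A_hat *v x = (P ** B) *v x" for x
    proof -
      have "A_hat *v x = (\<Sum>i = 1..r. (singular_value B i * (v i \<bullet> x)) *\<^sub>R u i)"
        by (simp add: A_hat sum_matrix_vec outer_prod_mult_vec scaleR_matrix_vector_assoc[symmetric])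
      also have "\<dots> = P *v (B *v x)"
        unfolding P_def proj_matrix_mult_vec
        by (rule sum.cong) (use r svd_with_inner_mult[OF uv] in auto)
      finally show ?thesis by (simp only: matrix_vector_mul_assoc)
    qed
    then show ?thesis unfolding matrix_eq by blast
  qed
  define X where "X = P ** Z"
  define Y where "Y = (P - mat 1) ** A"
  have mult: "X *v x = P *v (Z *v x)" "Y *v x = P *v (A *v x) - A *v x" for x
    unfolding X_def Y_def matrix_vector_mul_assoc[symmetric]
    by (simp_all add: matrix_vector_mult_diff_rdistrib)
  have XY: "A_hat - A = X + Y"
  proof -
    have "(A_hat - A) *v x = (X + Y) *v x" for x
      by (simp add: A_hat_proj assms(3) mult matrix_vector_mult_diff_rdistrib matrix_vector_mult_add_rdistrib
        matrix_vector_right_distrib flip: matrix_vector_mul_assoc)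
    then show ?thesis unfolding matrix_eq by blast
  qed
  have orth: "(X *v x) \<bullet> (Y *v x') = 0" for x x'
    unfolding mult P_def by (rule proj_matrix_orthogonal[OF u])
  have rank_X: "rank X \<le> r"
    using rank_mul_le_left[of P Z] rank_proj_matrix_le[of r u] by (simp add: X_def P_def)
  have rank_Y: "rank Y \<le> r"
    using rank_mul_le_right[of "P - mat 1" A] assms(4) by (simp add: Y_def)
  have sv_X: "singular_value X i \<le> singular_value Z i" if "i \<in> {1..N}" for i
    using that norm_proj_matrix_le(1)[OF u] by (intro singular_value_mono) (auto simp: mult P_def N_def)
  have sv_Z_PZ: "singular_value (Z - X) i \<le> singular_value Z i" if "i \<in> {1..N}" for i
    using that norm_proj_matrix_le(2)[OF u]
    by (intro singular_value_mono) (auto simp: mult P_def N_def matrix_vector_mult_diff_rdistrib)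
  have sv_rem: "singular_value (A_hat - B) i \<le> singular_value Z i" if i: "i \<in> {1..N}" for i
  proof -
    have "singular_value (A_hat - B) i = singular_value (B - A_hat) i"
      using singular_value_uminus[of i "B - A_hat"] i by (simp add: N_def)
    also have "\<dots> = (if r + i \<le> N then singular_value B (r + i) else 0)"
      using svd_with_remainder[OF uv r(2)] i by (simp add: A_hat N_def)
    also have "\<dots> \<le> singular_value Z i"
      using singular_value_add_le[of i A Z] singular_value_nonneg[of i Z] i assms(3,4) by (simp add: N_def)
    finally show ?thesis .
  qed
  have schatten_Z_max: "schatten_norm q Z_max = truncated_norm q r Z" if "0 < q" for q
  proof -
    have "schatten_norm q Z_max = truncated_norm q r Z_max"
      using r(2) sv_Z_max by (intro schatten_norm_eq_truncated_if_zero) (auto simp: N_def)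
    also have "\<dots> = truncated_norm q r Z"
      using r(2) sv_Z_max by (simp add: truncated_norm_def N_def)
    finally show ?thesis .
  qed
  have X_le: "schatten_norm q X \<le> schatten_norm q Z_max" if q: "1 \<le> q" for q
  proof -
    have "schatten_norm q X = truncated_norm q r X"
      using r(2) rank_X by (intro schatten_norm_eq_truncated_if_zero singular_value_eq_0_if_rank_less) auto
    also have "\<dots> \<le> truncated_norm q r Z"
      using q r(2) sv_X by (intro truncated_norm_mono) (auto simp: N_def)
    finally show ?thesis using q by (simp add: schatten_Z_max)
  qed
  have Y_le: "schatten_norm q Y \<le> 2 * schatten_norm q Z_max" if q: "1 \<le> q" for q
  proof -
    have "Y = (A_hat - B) + (Z - X)"
      using XY assms(3) by (simp add: algebra_simps)
    moreover have "schatten_norm q Y = truncated_norm q r Y"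
      using r(2) rank_Y by (intro schatten_norm_eq_truncated_if_zero singular_value_eq_0_if_rank_less) auto
    ultimately have "schatten_norm q Y \<le> truncated_norm q r (A_hat - B) + truncated_norm q r (Z - X)"
      using truncated_norm_triangle[OF r q, of "A_hat - B" "Z - X"] by simp
    also have "\<dots> \<le> truncated_norm q r Z + truncated_norm q r Z"
      using q r(2) sv_rem sv_Z_PZ by (intro add_mono truncated_norm_mono) (auto simp: N_def)
    finally show ?thesis using q by (simp add: schatten_Z_max)
  qed
  have "schatten_norm q (A_hat - A) \<le> (2 powr q + 1) powr (1 / q) * schatten_norm q Z_max"
    if q: "1 \<le> q" "q \<le> 2" for q
  proof -
    define T where "T = schatten_norm q Z_max"
    have T: "0 \<le> T" by (simp add: T_def schatten_norm_nonneg)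
    have "schatten_norm q (A_hat - A) powr q \<le> schatten_norm q X powr q + schatten_norm q Y powr q"
      unfolding XY using q by (intro schatten_norm_add_le_2 orth) auto
    also have "\<dots> \<le> T powr q + (2 * T) powr q"
      unfolding T_def using q X_le Y_le by (intro add_mono powr_mono2 schatten_norm_nonneg) auto
    also have "\<dots> = (2 powr q + 1) * T powr q"
      using T by (simp add: powr_mult algebra_simps)
    finally have "(schatten_norm q (A_hat - A) powr q) powr (1 / q) \<le> ((2 powr q + 1) * T powr q) powr (1 / q)"
      using q by (intro powr_mono2) auto
    then show ?thesis
      using q T schatten_norm_nonneg[of q "A_hat - A"] by (simp add: powr_mult powr_powr T_def)
  qed
  moreover have "schatten_norm q (A_hat - A) \<le> sqrt 5 * schatten_norm q Z_max" if q: "2 \<le> q" for q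
  proof -
    define T where "T = schatten_norm q Z_max"
    have T: "0 \<le> T" by (simp add: T_def schatten_norm_nonneg)
    have "(schatten_norm q (A_hat - A))\<^sup>2 \<le> (schatten_norm q X)\<^sup>2 + (schatten_norm q Y)\<^sup>2"
      unfolding XY using q by (intro schatten_norm_add_ge_2 orth)
    also have "\<dots> \<le> T\<^sup>2 + (2 * T)\<^sup>2"
      unfolding T_def using q X_le Y_le by (intro add_mono power_mono schatten_norm_nonneg) auto
    also have "\<dots> = (sqrt 5 * T)\<^sup>2"
      by (simp add: power_mult_distrib)
    finally have "schatten_norm q (A_hat - A) \<le> sqrt 5 * T"
      by (rule power2_le_imp_le) (use T in simp)
    then show ?thesis by (simp add: T_def)
  qed
  moreover have "spectral_norm (A_hat - A) \<le> 2 * spectral_norm Z_max"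
  proof -
    have one: "1 \<in> {1..N}" using r by (simp add: N_def)
    have norm1: "truncated_norm 1 1 M = singular_value M 1" for M :: "real ^ 'n ^ 'm"
      using singular_value_nonneg[of 1 M] one by (simp add: truncated_norm_def N_def)
    have eq: "(A_hat - B) + Z = A_hat - A" by (simp add: assms(3))
    have "truncated_norm 1 1 ((A_hat - B) + Z) \<le> truncated_norm 1 1 (A_hat - B) + truncated_norm 1 1 Z"
      using r by (intro truncated_norm_triangle) auto
    then have "singular_value (A_hat - A) 1 \<le> singular_value (A_hat - B) 1 + singular_value Z 1"
      unfolding norm1 eq .
    then show ?thesis
      using sv_rem[OF one] sv_Z_max[OF one] r by (simp add: spectral_norm_def)
  qed
  ultimately show ?thesis by blast
qed

end
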